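(* Let $\tau$ be the maximizer of $W$ on $[0,1]$. There exists a sequence $(E_n)_{n\in\mathbb N}$ of closed nowhere dense subsets of $[0,1]$ that is nonincreasing to $\emptyset$ $\mathscr L$-a.e. (i.e. $E_{n+1}\subset E_n$ for all $n$ and $\mathscr L(\bigcap_nE_n)=0$) and such that $\mathbb Q(\tau=\tau_{E_n})>0$ for all $n\in\mathbb N$.
   Context: $\mathscr L$ is Lebesgue measure on $\mathbb R$. $\Omega_0$ is the set of continuous $\omega:\mathbb R\to\mathbb R$ with $\omega(0)=0$ having countably infinitely many (times of strict) local maxima; $\mathbb W$ is the completed two-sided Wiener measure on $\Omega_0$, $W$ the coordinate process. The maximizer $\tau$ of $W$ on $[0,1]$ is the ($\mathbb W$-a.s. unique) time at which $W$ attains its maximum on $[0,1]$ (with a value $\dagger\notin\mathbb R$ on the null event where this time is not unique or is not a local maximum of $W$). $\mathbb Q$ is a complete extension of $\mathbb W$ (random elements under $\mathbb W$ being regarded as random elements under $\mathbb Q$) supporting an $\Omega_0$-valued two-sided Brownian motion $W'$ independent of $W$. For Lebesgue-measurable $E$, $\mathbf 1_E\cdot W$ is the continuous version, vanishing at $0$, of $t\mapsto\int_0^t\mathbf 1_E(s)\,dW_s$; $W_E=\mathbf 1_E\cdot W+\mathbf 1_{\mathbb R\setminus E}\cdot W'$, taken $\Omega_0$-valued, and $\tau_E=\tau(W_E)$, i.e. $\tau_E$ is the maximizer of $W_E$ on $[0,1]$. *)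

theory Defs
  imports "HOL-Probability.Probability"
begin

text \<open>Local maxima are always strict ones.\<close>

definition local_maxima :: "(real \<Rightarrow> real) \<Rightarrow> real set" where
  "local_maxima \<omega> = {t. eventually (\<lambda>s. \<omega> s < \<omega> t) (at t)}"

definition Omega0 :: "(real \<Rightarrow> real) set" where
  "Omega0 = {\<omega>. continuous_on UNIV \<omega> \<and> \<omega> 0 = 0 \<and>
                countable (local_maxima \<omega>) \<and> infinite (local_maxima \<omega>)}"

text \<open>The \<open>\<sigma>\<close>-algebra on \<^const>\<open>Omega0\<close> generated by the coordinate maps. Only the space and
  the measurable sets of \<open>path_space\<close> matter.\<close>

definition path_space :: "(real \<Rightarrow> real) measure" where
  "path_space = restrict_space (\<Pi>\<^sub>M t\<in>(UNIV :: real set). (borel :: real measure)) Omega0"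

text \<open>Two-sided standard Brownian motion, as a process with independent centred Gaussian
  increments over the whole line (this includes the independence of the two halves).\<close>

definition two_sided_brownian_motion :: "'a measure \<Rightarrow> ('a \<Rightarrow> real \<Rightarrow> real) \<Rightarrow> bool" where
  "two_sided_brownian_motion M B \<longleftrightarrow>
     prob_space M \<and>
     (\<forall>x\<in>space M. continuous_on UNIV (B x) \<and> B x 0 = 0) \<and>
     (\<forall>t. (\<lambda>x. B x t) \<in> borel_measurable M) \<and>
     (\<forall>s t. s < t \<longrightarrow>
        distributed M lborel (\<lambda>x. B x t - B x s) (normal_density 0 (sqrt (t - s)))) \<and>
     (\<forall>(n :: nat) (u :: nat \<Rightarrow> real). strict_mono_on {..n} u \<longrightarrow>
        prob_space.indep_vars M (\<lambda>_. borel) (\<lambda>i x. B x (u (Suc i)) - B x (u i)) {..<n})"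

text \<open>Characterises the completed Wiener measure on \<^const>\<open>Omega0\<close> uniquely: under it the coordinate
  process is a two-sided Brownian motion.\<close>

definition completed_wiener_measure :: "(real \<Rightarrow> real) measure \<Rightarrow> bool" where
  "completed_wiener_measure P \<longleftrightarrow>
     (\<exists>M. sets M = sets path_space \<and> two_sided_brownian_motion M (\<lambda>\<omega>. \<omega>) \<and> P = completion M)"

text \<open>An extension comes with a measure-preserving map \<open>p\<close>; a random element \<open>X\<close> under \<open>P\<close> is
  regarded as the random element \<open>X \<circ> p\<close> under \<open>Q\<close>. For \<open>P\<close> on path space, \<open>p\<close> itself is
  therefore the coordinate process regarded as a process under \<open>Q\<close>.\<close>

definition complete_extension :: "'b measure \<Rightarrow> 'a measure \<Rightarrow> ('a \<Rightarrow> 'b) \<Rightarrow> bool" where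
  "complete_extension P Q p \<longleftrightarrow>
     prob_space Q \<and> complete_measure Q \<and> p \<in> Q \<rightarrow>\<^sub>M P \<and> distr Q P p = P"

text \<open>The list entry \<open>(c, a, b)\<close> stands for the step function with value \<open>c\<close> on \<open>(a, b]\<close>.\<close>

definition step_fun :: "(real \<times> real \<times> real) list \<Rightarrow> real \<Rightarrow> real" where
  "step_fun l s = (\<Sum>(c, a, b)\<leftarrow>l. c * indicator {a<..b} s)"

definition step_integral :: "(real \<times> real \<times> real) list \<Rightarrow> (real \<Rightarrow> real) \<Rightarrow> real" where
  "step_integral l \<beta> = (\<Sum>(c, a, b)\<leftarrow>l. c * (\<beta> b - \<beta> a))"

text \<open>\<open>X\<close> is a version of the integral of the deterministic square-integrable function \<open>f\<close>
  over the line against \<open>B\<close>: the \<open>L\<^sup>2\<close>-limit of the integrals of step functions converging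
  to \<open>f\<close> in \<open>L\<^sup>2\<close>. By the isometry, \<open>X\<close> is determined up to almost sure equality.\<close>

definition is_wiener_integral ::
    "'a measure \<Rightarrow> ('a \<Rightarrow> real \<Rightarrow> real) \<Rightarrow> (real \<Rightarrow> real) \<Rightarrow> ('a \<Rightarrow> real) \<Rightarrow> bool" where
  "is_wiener_integral M B f X \<longleftrightarrow>
     f \<in> borel_measurable lebesgue \<and> X \<in> borel_measurable M \<and>
     (\<exists>l :: nat \<Rightarrow> (real \<times> real \<times> real) list.
        (\<forall>k. \<forall>(c, a, b)\<in>set (l k). a \<le> b) \<and>
        (\<lambda>k. \<integral>\<^sup>+ s. ennreal ((f s - step_fun (l k) s)\<^sup>2) \<partial>lebesgue) \<longlonglongrightarrow> 0 \<and>
        (\<lambda>k. \<integral>\<^sup>+ x. ennreal ((X x - step_integral (l k) (B x))\<^sup>2) \<partial>M) \<longlonglongrightarrow> 0)"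

text \<open>The integrand on the whole line for the integral of the indicator of \<open>E\<close> from \<open>0\<close> to \<open>t\<close>,
  with the usual sign convention for negative \<open>t\<close>.\<close>

definition oriented_indicator :: "real set \<Rightarrow> real \<Rightarrow> real \<Rightarrow> real" where
  "oriented_indicator E t s =
     (if 0 \<le> t then indicator (E \<inter> {0<..t}) s else - indicator (E \<inter> {t<..0}) s)"

text \<open>\<open>Z\<close> is the process \<open>1\<^sub>E \<cdot> B\<close>, which is unique up to indistinguishability.\<close>

definition is_indicator_integral ::
    "'a measure \<Rightarrow> real set \<Rightarrow> ('a \<Rightarrow> real \<Rightarrow> real) \<Rightarrow> ('a \<Rightarrow> real \<Rightarrow> real) \<Rightarrow> bool" where
  "is_indicator_integral M E B Z \<longleftrightarrow>
     (\<forall>x\<in>space M. continuous_on UNIV (Z x) \<and> Z x 0 = 0) \<and>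
     (\<forall>t. is_wiener_integral M B (oriented_indicator E t) (\<lambda>x. Z x t))"

text \<open>\<open>Y\<close> is an \<^const>\<open>Omega0\<close>-valued version of \<open>1\<^sub>E \<cdot> W + 1\<^sub>(\<real> \<setminus> E) \<cdot> W'\<close>.\<close>

definition is_mixture :: "'a measure \<Rightarrow> ('a \<Rightarrow> real \<Rightarrow> real) \<Rightarrow> ('a \<Rightarrow> real \<Rightarrow> real) \<Rightarrow>
    real set \<Rightarrow> ('a \<Rightarrow> real \<Rightarrow> real) \<Rightarrow> bool" where
  "is_mixture Q W W' E Y \<longleftrightarrow>
     Y \<in> Q \<rightarrow>\<^sub>M path_space \<and>
     (\<exists>Z Z'. is_indicator_integral Q E W Z \<and> is_indicator_integral Q (- E) W' Z' \<and>
        (AE x in Q. \<forall>t. Y x t = Z x t + Z' x t))"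

definition is_max_time :: "(real \<Rightarrow> real) \<Rightarrow> real \<Rightarrow> bool" where
  "is_max_time \<omega> t \<longleftrightarrow> t \<in> {0..1} \<and> (\<forall>s\<in>{0..1}. \<omega> s \<le> \<omega> t)"

text \<open>\<^const>\<open>None\<close> plays the role of the exceptional value outside \<open>\<real>\<close>.\<close>

definition maximizer :: "(real \<Rightarrow> real) \<Rightarrow> real option" where
  "maximizer \<omega> =
     (if (\<exists>!t. is_max_time \<omega> t) \<and> (THE t. is_max_time \<omega> t) \<in> local_maxima \<omega>
      then Some (THE t. is_max_time \<omega> t) else None)"

definition nowhere_dense :: "real set \<Rightarrow> bool" where
  "nowhere_dense S \<longleftrightarrow> interior (closure S) = {}"

end

theory Submission
  imports Defs
begin

text \<open>
  Let \<open>\<tau>\<close> be the maximum time of \<open>W\<close> on \<open>[0, 1]\<close>. Take \<open>E n\<close> as the intersection of \<open>[0, a n]\<close>, where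
  \<open>a n = 1 / (n + 2)\<close>, with one fixed closed nowhere dense set \<open>F\<close>, whose complement in \<open>[0, 1]\<close> is a dense
  union of extremely short disjoint open intervals, the holes. Up to time \<open>a n\<close>, the mixture \<open>Y\<close> is \<open>W\<close>
  plus the increments of \<open>W' - W\<close> across the holes; afterwards it follows the increments of \<open>W'\<close>.

  The holes are harmless if each is chosen after the scales that it must not disturb
  (\<open>quiet_interval\<close>). A hole is centred at a point \<open>q\<close> that is not an atom of the law of \<open>\<tau>\<close>. Then,
  up to small probability, \<open>\<tau>\<close> stays at some distance from \<open>q\<close>, and by uniqueness of the maximum \<open>W\<close> is
  below its maximum by some fixed amount away from \<open>\<tau>\<close>. A sufficiently short hole contributes much less
  than this gap, by continuity of the paths. With summable bounds for the holes, the whole perturbation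
  between \<open>\<tau>\<close> and \<open>t\<close> is at most half of \<open>W \<tau> - W t\<close>, so \<open>\<tau>\<close> is still the maximum time of \<open>Y\<close> on
  \<open>[0, a n]\<close> (\<open>same_maximum\<close>). The only facts about Brownian motion used here are continuity and almost
  sure uniqueness of the maximum (\<open>unique_maximum\<close>).

  It remains to keep \<open>Y\<close> low after \<open>a n\<close>. With positive probability \<open>W\<close> falls far below its maximum before
  \<open>a n\<close> and stays there, and, independently, \<open>W'\<close> does not rise much after \<open>a n\<close>
  (\<open>independent_start_pos\<close>). This probability, while positive, tends to \<open>0\<close> with \<open>n\<close>, and \<open>F\<close> must serve all
  \<open>n\<close>. But a hole matters only for those finitely many \<open>n\<close> for which it meets \<open>[0, a n]\<close>, so its
  exceptional event can be made small compared to all the probabilities in question.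

  The Wiener integrals of the indicators are identified with the pathwise series over the holes by the
  isometry for step functions (\<open>wiener_integral_eq_limit\<close>, \<open>mixture_path\<close>).
\<close>

section \<open>Maxima of continuous paths\<close>

definition maxval :: "(real \<Rightarrow> real) \<Rightarrow> real \<Rightarrow> real \<Rightarrow> real" where
  "maxval \<omega> a b = Sup (\<omega> ` {a..b})"

text \<open>The maximum over an equidistant grid depends on finitely many increments only, which is what
  the independence of increments speaks about; it converges to the maximum over the interval for
  continuous paths.\<close>

definition grid_max :: "(real \<Rightarrow> real) \<Rightarrow> real \<Rightarrow> real \<Rightarrow> nat \<Rightarrow> real" where
  "grid_max \<omega> a b m = Max ((\<lambda>i. \<omega> (a + (b - a) * real i / real (Suc m))) ` {..Suc m})"

definition first_max :: "(real \<Rightarrow> real) \<Rightarrow> real \<Rightarrow> real \<Rightarrow> real" where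
  "first_max \<omega> a b = Inf {t \<in> {a..b}. \<omega> t = maxval \<omega> a b}"

text \<open>By reflection, everything about last maximum times follows from first maximum times.\<close>

definition last_max :: "(real \<Rightarrow> real) \<Rightarrow> real \<Rightarrow> real \<Rightarrow> real" where
  "last_max \<omega> a b = - first_max (\<lambda>t. \<omega> (- t)) (- b) (- a)"

lemma maxval_attained:
  assumes "continuous_on UNIV \<omega>" "a \<le> b"
  shows "\<exists>t\<in>{a..b}. \<omega> t = maxval \<omega> a b \<and> (\<forall>s\<in>{a..b}. \<omega> s \<le> \<omega> t)"
proof -
  have "compact {a..b}" "{a..b} \<noteq> {}" "continuous_on {a..b} \<omega>"
    using assms continuous_on_subset by auto
  then obtain t where t: "t \<in> {a..b}" "\<forall>s\<in>{a..b}. \<omega> s \<le> \<omega> t"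
    using continuous_attains_sup by blast
  then have "maxval \<omega> a b = \<omega> t"
    unfolding maxval_def by (intro cSup_eq_maximum) auto
  with t show ?thesis by auto
qed

lemma maxval_upper:
  assumes "continuous_on UNIV \<omega>" "t \<in> {a..b}"
  shows "\<omega> t \<le> maxval \<omega> a b"
proof -
  have "a \<le> b" using assms(2) by auto
  then show ?thesis using maxval_attained[OF assms(1), of a b] assms(2) by auto
qed

lemma maxval_le_iff:
  assumes "continuous_on UNIV \<omega>" "a \<le> b"
  shows "maxval \<omega> a b \<le> c \<longleftrightarrow> (\<forall>t\<in>{a..b}. \<omega> t \<le> c)"
proof -
  obtain u where u: "u \<in> {a..b}" "\<omega> u = maxval \<omega> a b" "\<forall>s\<in>{a..b}. \<omega> s \<le> \<omega> u"
    using maxval_attained[OF assms] by blast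
  show ?thesis
    using u(1) u(3) order_trans unfolding u(2)[symmetric] by blast
qed

lemma maxval_mono:
  assumes "continuous_on UNIV \<omega>" "a \<le> b" "{a..b} \<subseteq> {c..d}"
  shows "maxval \<omega> a b \<le> maxval \<omega> c d"
  unfolding maxval_le_iff[OF assms(1,2)] using maxval_upper[OF assms(1)] assms(3) by blast

lemma maxval_shift:
  assumes "continuous_on UNIV \<omega>" "a \<le> b"
  shows "maxval (\<lambda>t. \<omega> t - k) a b = maxval \<omega> a b - k"
proof -
  obtain t where t: "t \<in> {a..b}" "\<omega> t = maxval \<omega> a b" "\<forall>s\<in>{a..b}. \<omega> s \<le> \<omega> t"
    using maxval_attained[OF assms] by blast
  then show ?thesis
    unfolding t(2)[symmetric] unfolding maxval_def by (intro cSup_eq_maximum) auto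
qed

lemma grid_mem:
  assumes "a \<le> b" "i \<le> Suc m"
  shows "a + (b - a) * real i / real (Suc m) \<in> {a..b}"
proof -
  have "real i / real (Suc m) \<le> 1" using assms(2) by simp
  then have "(b - a) * (real i / real (Suc m)) \<le> (b - a) * 1"
    using assms(1) by (intro mult_left_mono) auto
  then show ?thesis using assms by simp
qed

lemma grid_max_le:
  assumes "continuous_on UNIV \<omega>" "a \<le> b"
  shows "grid_max \<omega> a b m \<le> maxval \<omega> a b"
  unfolding grid_max_def
  using maxval_upper[OF assms(1) grid_mem[OF assms(2)]] by (auto intro!: Max.boundedI)

lemma grid_max_tendsto:
  assumes c: "continuous_on UNIV \<omega>" and ab: "a \<le> b"
  shows "grid_max \<omega> a b \<longlonglongrightarrow> maxval \<omega> a b"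
proof -
  obtain t where t: "t \<in> {a..b}" "\<omega> t = maxval \<omega> a b"
    using maxval_attained[OF assms] by auto
  obtain u where u: "u \<in> {0..1}" "t = a + (b - a) * u"
  proof (cases "a = b")
    case True then show ?thesis using t that[of 0] by auto
  next
    case False
    then show ?thesis using t ab by (intro that[of "(t - a) / (b - a)"]) (auto simp: field_simps)
  qed
  define i where "i m = nat \<lfloor>u * real (Suc m)\<rfloor>" for m
  have i: "i m \<le> Suc m" for m
  proof -
    have "u * real (Suc m) \<le> 1 * real (Suc m)" using u by (intro mult_right_mono) auto
    moreover have "real (i m) \<le> u * real (Suc m)"
      unfolding i_def using u(1) by (intro of_nat_floor) auto
    ultimately have "real (i m) \<le> 1 * real (Suc m)" by (rule order_trans[rotated])
    then show ?thesis by simp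
  qed
  have "(\<lambda>m. real (i m) / real (Suc m)) \<longlonglongrightarrow> u"
  proof (rule tendsto_sandwich[OF _ _ _ tendsto_const])
    show "(\<lambda>m. u - 1 / real (Suc m)) \<longlonglongrightarrow> u"
      using LIMSEQ_inverse_real_of_nat tendsto_diff[OF tendsto_const, of _ 0 sequentially u]
      by (simp add: inverse_eq_divide)
    have "u * real (Suc m) - 1 \<le> real (i m)" "real (i m) \<le> u * real (Suc m)" for m
      using u(1) unfolding i_def by auto
    then have "(u * real (Suc m) - 1) / real (Suc m) \<le> real (i m) / real (Suc m)"
      "real (i m) / real (Suc m) \<le> u * real (Suc m) / real (Suc m)" for m
      by (intro divide_right_mono; simp)+
    then show "\<forall>\<^sub>F m in sequentially. u - 1 / real (Suc m) \<le> real (i m) / real (Suc m)"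
      "\<forall>\<^sub>F m in sequentially. real (i m) / real (Suc m) \<le> u"
      by (simp_all add: diff_divide_distrib del: of_nat_Suc)
  qed
  then have "(\<lambda>m. a + (b - a) * (real (i m) / real (Suc m))) \<longlonglongrightarrow> t"
    unfolding u(2) by (intro tendsto_intros)
  then have "(\<lambda>m. \<omega> (a + (b - a) * (real (i m) / real (Suc m)))) \<longlonglongrightarrow> \<omega> t"
    by (intro continuous_on_tendsto_compose[OF c]) auto
  then have lim: "(\<lambda>m. \<omega> (a + (b - a) * real (i m) / real (Suc m))) \<longlonglongrightarrow> maxval \<omega> a b"
    using t(2) by simp
  show ?thesis
  proof (rule tendsto_sandwich[OF _ _ lim tendsto_const])
    show "\<forall>\<^sub>F m in sequentially. grid_max \<omega> a b m \<le> maxval \<omega> a b"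
      using grid_max_le[OF assms] by simp
    show "\<forall>\<^sub>F m in sequentially. \<omega> (a + (b - a) * real (i m) / real (Suc m)) \<le> grid_max \<omega> a b m"
      unfolding grid_max_def using i by (auto intro!: Max_ge simp del: of_nat_Suc)
  qed
qed

lemma first_max_props:
  assumes "continuous_on UNIV \<omega>" "a \<le> b"
  shows "first_max \<omega> a b \<in> {a..b}" "\<omega> (first_max \<omega> a b) = maxval \<omega> a b"
    "t \<in> {a..b} \<Longrightarrow> \<omega> t = maxval \<omega> a b \<Longrightarrow> first_max \<omega> a b \<le> t"
proof -
  let ?S = "{t \<in> {a..b}. \<omega> t = maxval \<omega> a b}"
  have eq: "?S = {a..b} \<inter> \<omega> -` {maxval \<omega> a b}" by auto
  have cl: "closed ?S" unfolding eq
    using assms(1) by (intro continuous_closed_preimage continuous_on_subset[OF assms(1)]) auto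
  have ne: "?S \<noteq> {}" and bd: "bdd_below ?S" using maxval_attained[OF assms] by auto
  from closed_contains_Inf[OF ne bd cl]
  show "first_max \<omega> a b \<in> {a..b}" "\<omega> (first_max \<omega> a b) = maxval \<omega> a b"
    unfolding first_max_def by auto
  show "first_max \<omega> a b \<le> t" if "t \<in> {a..b}" "\<omega> t = maxval \<omega> a b"
    unfolding first_max_def using that bd by (intro cInf_lower) auto
qed

lemma maxval_reflect:
  "maxval (\<lambda>t. \<omega> (- t)) (- b) (- a) = maxval \<omega> a b"
proof -
  have "uminus ` {- b..- a} = {a..b}" by simp
  then have "(\<lambda>t. \<omega> (- t)) ` {- b..- a} = \<omega> ` {a..b}" by (metis image_image)
  then show ?thesis unfolding maxval_def by simp
qed

lemma last_max_props:
  assumes "continuous_on UNIV \<omega>" "a \<le> b"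
  shows "last_max \<omega> a b \<in> {a..b}" "\<omega> (last_max \<omega> a b) = maxval \<omega> a b"
    "t \<in> {a..b} \<Longrightarrow> \<omega> t = maxval \<omega> a b \<Longrightarrow> t \<le> last_max \<omega> a b"
proof -
  have c: "continuous_on UNIV (\<lambda>t. \<omega> (- t))"
    using assms(1) by (intro continuous_on_compose2[OF assms(1)] continuous_intros) auto
  note p = first_max_props[OF c, of "- b" "- a", unfolded maxval_reflect]
  show "last_max \<omega> a b \<in> {a..b}" "\<omega> (last_max \<omega> a b) = maxval \<omega> a b"
    "t \<in> {a..b} \<Longrightarrow> \<omega> t = maxval \<omega> a b \<Longrightarrow> t \<le> last_max \<omega> a b"
    using p(1,2) p(3)[of "- t"] assms(2) unfolding last_max_def by auto
qed

lemma first_eq_last_iff: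
  assumes "continuous_on UNIV \<omega>" "a \<le> b" "u \<in> {a..b}"
  shows "first_max \<omega> a b = u \<and> last_max \<omega> a b = u \<longleftrightarrow> (\<forall>t\<in>{a..b}. t \<noteq> u \<longrightarrow> \<omega> t < \<omega> u)"
proof
  assume u: "first_max \<omega> a b = u \<and> last_max \<omega> a b = u"
  show "\<forall>t\<in>{a..b}. t \<noteq> u \<longrightarrow> \<omega> t < \<omega> u"
  proof (intro ballI impI)
    fix t assume t: "t \<in> {a..b}" "t \<noteq> u"
    have "\<omega> t \<noteq> maxval \<omega> a b"
      using first_max_props(3)[OF assms(1,2) t(1)] last_max_props(3)[OF assms(1,2) t(1)] t u by auto
    then show "\<omega> t < \<omega> u"
      using maxval_upper[OF assms(1) t(1)] first_max_props(2)[OF assms(1,2)] u by auto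
  qed
next
  assume u: "\<forall>t\<in>{a..b}. t \<noteq> u \<longrightarrow> \<omega> t < \<omega> u"
  have "\<omega> u \<le> maxval \<omega> a b" using maxval_upper assms by blast
  then have "t = u" if "t \<in> {a..b}" "\<omega> t = maxval \<omega> a b" for t
    using u that by fastforce
  then show "first_max \<omega> a b = u \<and> last_max \<omega> a b = u"
    using first_max_props(1,2)[OF assms(1,2)] last_max_props(1,2)[OF assms(1,2)] by blast
qed

lemma maximizer_Some:
  assumes "0 < u" "u < 1" "\<And>t. t \<in> {0..1} \<Longrightarrow> t \<noteq> u \<Longrightarrow> \<omega> t < \<omega> u"
  shows "maximizer \<omega> = Some u"
proof -
  have m: "is_max_time \<omega> t \<longleftrightarrow> t = u" for t
  proof
    assume t: "is_max_time \<omega> t"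
    then have "\<omega> u \<le> \<omega> t" "t \<in> {0..1}" using assms(1,2) unfolding is_max_time_def by auto
    then show "t = u" using assms(3)[of t] by auto
  next
    assume "t = u"
    moreover have "\<omega> s \<le> \<omega> u" if "s \<in> {0..1}" for s
      using assms(3)[OF that] by (cases "s = u") auto
    ultimately show "is_max_time \<omega> t" using assms(1,2) unfolding is_max_time_def by auto
  qed
  have "\<forall>\<^sub>F s in at u. s \<in> {0<..<1}"
    using assms(1,2) by (intro eventually_at_in_open') auto
  then have "u \<in> local_maxima \<omega>"
    unfolding local_maxima_def
    using assms(3) by (auto simp: eventually_at_filter elim!: eventually_mono)
  moreover have "is_max_time \<omega> = (\<lambda>t. t = u)" using m by blast
  ultimately show ?thesis unfolding maximizer_def by simp
qed

text \<open>The condition that the maximum time be a strict local maximum on the whole line matters only if it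
  is an endpoint of \<open>[0, 1]\<close>. There it says that the endpoint is the unique maximum time on some short
  interval outside \<open>[0, 1]\<close>, so \<^const>\<open>maximizer\<close> is expressed by countably many first and last
  maximum times, which are measurable.\<close>

lemma maximizer_eq:
  assumes c: "continuous_on UNIV \<omega>"
  shows "maximizer \<omega> =
    (if first_max \<omega> 0 1 = last_max \<omega> 0 1 \<and>
        (first_max \<omega> 0 1 \<noteq> 0 \<or> (\<exists>n. first_max \<omega> (- 1 / real (Suc n)) 0 = 0)) \<and>
        (first_max \<omega> 0 1 \<noteq> 1 \<or> (\<exists>n. last_max \<omega> 1 (1 + 1 / real (Suc n)) = 1))
     then Some (first_max \<omega> 0 1) else None)" (is "_ = (if ?c then _ else _)")
proof -
  define u where "u = first_max \<omega> 0 1"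
  have u: "u \<in> {0..1}" "\<And>t. t \<in> {0..1} \<Longrightarrow> \<omega> t \<le> \<omega> u"
    using first_max_props(1,2)[OF c, of 0 1] maxval_upper[OF c, of _ 0 1] unfolding u_def by auto
  have uniq: "(\<exists>!t. is_max_time \<omega> t) \<longleftrightarrow> u = last_max \<omega> 0 1"
  proof
    assume "\<exists>!t. is_max_time \<omega> t"
    moreover have "is_max_time \<omega> u" using u unfolding is_max_time_def by auto
    moreover have "is_max_time \<omega> (last_max \<omega> 0 1)"
      using last_max_props(1,2)[OF c, of 0 1] maxval_upper[OF c, of _ 0 1]
      unfolding is_max_time_def by auto
    ultimately show "u = last_max \<omega> 0 1" by auto
  next
    assume "u = last_max \<omega> 0 1"
    then have "\<forall>t\<in>{0..1}. t \<noteq> u \<longrightarrow> \<omega> t < \<omega> u"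
      using first_eq_last_iff[OF c, of 0 1 u] u unfolding u_def by auto
    then show "\<exists>!t. is_max_time \<omega> t"
      using u unfolding is_max_time_def by (metis less_le_not_le)
  qed
  have the: "(THE t. is_max_time \<omega> t) = u" if "\<exists>!t. is_max_time \<omega> t"
    using that u by (intro the1_equality) (auto simp: is_max_time_def)
  have left: "first_max \<omega> (- 1 / real (Suc n)) 0 = 0 \<longleftrightarrow> (\<forall>t. - 1 / real (Suc n) \<le> t \<and> t < 0 \<longrightarrow> \<omega> t < \<omega> 0)" (is "?l \<longleftrightarrow> ?r") for n
  proof -
    have le: "- 1 / real (Suc n) \<le> 0" by simp
    have "last_max \<omega> (- 1 / real (Suc n)) 0 = 0" if ?l
      using first_max_props(2)[OF c le] that last_max_props(1,2)[OF c le] last_max_props(3)[OF c le, of 0] by auto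
    then show ?thesis using first_eq_last_iff[OF c le, of 0] le by force
  qed
  have right: "last_max \<omega> 1 (1 + 1 / real (Suc n)) = 1 \<longleftrightarrow> (\<forall>t. 1 < t \<and> t \<le> 1 + 1 / real (Suc n) \<longrightarrow> \<omega> t < \<omega> 1)" (is "?l \<longleftrightarrow> ?r") for n
  proof -
    have le: "1 \<le> 1 + 1 / real (Suc n)" by simp
    have "first_max \<omega> 1 (1 + 1 / real (Suc n)) = 1" if ?l
      using last_max_props(2)[OF c le] that first_max_props(1,2)[OF c le] first_max_props(3)[OF c le, of 1] by auto
    then show ?thesis using first_eq_last_iff[OF c le, of 1] le by force
  qed
  have loc: "u \<in> local_maxima \<omega> \<longleftrightarrow>
        (u \<noteq> 0 \<or> (\<exists>n. first_max \<omega> (- 1 / real (Suc n)) 0 = 0)) \<and>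
        (u \<noteq> 1 \<or> (\<exists>n. last_max \<omega> 1 (1 + 1 / real (Suc n)) = 1))"
    if ul: "u = last_max \<omega> 0 1"
  proof -
    have str: "\<omega> t < \<omega> u" if "t \<in> {0..1}" "t \<noteq> u" for t
      using first_eq_last_iff[OF c, of 0 1 u] u ul that unfolding u_def by auto
    have near: "(\<forall>\<^sub>F s in at u. \<omega> s < \<omega> u) \<longleftrightarrow> (\<exists>n. \<forall>s. \<bar>s - u\<bar> \<le> 1 / real (Suc n) \<and> s \<noteq> u \<longrightarrow> \<omega> s < \<omega> u)"
    proof
      assume "\<forall>\<^sub>F s in at u. \<omega> s < \<omega> u"
      then obtain d where d: "d > 0" "\<forall>s. s \<noteq> u \<and> dist s u < d \<longrightarrow> \<omega> s < \<omega> u"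
        unfolding eventually_at by auto
      obtain n where "inverse (real (Suc n)) < d" using reals_Archimedean[OF d(1)] by blast
      then show "\<exists>n. \<forall>s. \<bar>s - u\<bar> \<le> 1 / real (Suc n) \<and> s \<noteq> u \<longrightarrow> \<omega> s < \<omega> u"
        using d(2) by (intro exI[of _ n]) (auto simp: dist_real_def inverse_eq_divide)
    next
      assume "\<exists>n. \<forall>s. \<bar>s - u\<bar> \<le> 1 / real (Suc n) \<and> s \<noteq> u \<longrightarrow> \<omega> s < \<omega> u"
      then obtain n where "\<forall>s. \<bar>s - u\<bar> \<le> 1 / real (Suc n) \<and> s \<noteq> u \<longrightarrow> \<omega> s < \<omega> u" by blast
      then show "\<forall>\<^sub>F s in at u. \<omega> s < \<omega> u"
        unfolding eventually_at by (intro exI[of _ "1 / real (Suc n)"]) (auto simp: dist_real_def)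
    qed
    consider "u = 0" | "u = 1" | "0 < u" "u < 1" using u(1) by force
    then show ?thesis
    proof cases
      case 1
      have "\<omega> s < \<omega> u" if "\<forall>t. - 1 / real (Suc n) \<le> t \<and> t < 0 \<longrightarrow> \<omega> t < \<omega> 0"
         "\<bar>s - u\<bar> \<le> 1 / real (Suc n)" "s \<noteq> u" for s n
      proof (cases "s < 0")
        case True then show ?thesis using that 1 by auto
      next
        case False
        have "1 / real (Suc n) \<le> 1" by simp
        then have "s \<le> 1" using that(2) 1 by linarith
        then show ?thesis using False that(3) by (intro str) auto
      qed
      then have "(\<forall>s. \<bar>s - u\<bar> \<le> 1 / real (Suc n) \<and> s \<noteq> u \<longrightarrow> \<omega> s < \<omega> u) \<longleftrightarrow>
          (\<forall>t. - 1 / real (Suc n) \<le> t \<and> t < 0 \<longrightarrow> \<omega> t < \<omega> 0)" for n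
        using 1 by (auto simp del: of_nat_Suc)
      then show ?thesis using 1 near unfolding local_maxima_def left right by simp
    next
      case 2
      have "\<omega> s < \<omega> u" if "\<forall>t. 1 < t \<and> t \<le> 1 + 1 / real (Suc n) \<longrightarrow> \<omega> t < \<omega> 1"
         "\<bar>s - u\<bar> \<le> 1 / real (Suc n)" "s \<noteq> u" for s n
      proof (cases "s > 1")
        case True then show ?thesis using that 2 by auto
      next
        case False
        have "1 / real (Suc n) \<le> 1" by simp
        then have "0 \<le> s" using that(2) 2 by linarith
        then show ?thesis using False that(3) by (intro str) auto
      qed
      then have "(\<forall>s. \<bar>s - u\<bar> \<le> 1 / real (Suc n) \<and> s \<noteq> u \<longrightarrow> \<omega> s < \<omega> u) \<longleftrightarrow>
          (\<forall>t. 1 < t \<and> t \<le> 1 + 1 / real (Suc n) \<longrightarrow> \<omega> t < \<omega> 1)" for n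
        using 2 by (auto simp del: of_nat_Suc)
      then show ?thesis using 2 near unfolding local_maxima_def left right by simp
    next
      case 3
      have "\<forall>\<^sub>F s in at u. s \<in> {0<..<1}"
        using 3 by (intro eventually_at_in_open') auto
      then have "u \<in> local_maxima \<omega>"
        unfolding local_maxima_def
        using str by (auto simp: eventually_at_filter elim!: eventually_mono)
      with 3 show ?thesis by auto
    qed
  qed
  show ?thesis
    unfolding maximizer_def using uniq the loc unfolding u_def[symmetric] by auto
qed

section \<open>Measurability for continuous processes\<close>

definition continuous_process :: "'a measure \<Rightarrow> ('a \<Rightarrow> real \<Rightarrow> real) \<Rightarrow> bool" where
  "continuous_process M X \<longleftrightarrow> (\<forall>x\<in>space M. continuous_on UNIV (X x)) \<and>
     (\<forall>t. (\<lambda>x. X x t) \<in> borel_measurable M)"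

lemma path_space_process: "continuous_process path_space (\<lambda>\<omega>. \<omega>)"
  unfolding continuous_process_def path_space_def
  by (auto simp: space_restrict_space Omega0_def intro!: measurable_restrict_space1 measurable_component_singleton)

lemma continuous_process_compose:
  assumes "continuous_process N X" "p \<in> M \<rightarrow>\<^sub>M N"
  shows "continuous_process M (\<lambda>x. X (p x))"
  using assms measurable_space[OF assms(2)] unfolding continuous_process_def
  by (auto intro: measurable_compose[OF assms(2)])

lemma grid_max_measurable:
  assumes "continuous_process M X"
  shows "(\<lambda>x. grid_max (X x) a b m) \<in> borel_measurable M"
  unfolding grid_max_def using assms unfolding continuous_process_def
  by (intro borel_measurable_Max) auto

lemma maxval_measurable:
  assumes "continuous_process M X" "a \<le> b"
  shows "(\<lambda>x. maxval (X x) a b) \<in> borel_measurable M"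
proof (rule borel_measurable_LIMSEQ_real)
  show "(\<lambda>m. grid_max (X x) a b m) \<longlonglongrightarrow> maxval (X x) a b" if "x \<in> space M" for x
    using grid_max_tendsto[of "X x" a b] assms that unfolding continuous_process_def by simp
  show "(\<lambda>x. grid_max (X x) a b m) \<in> borel_measurable M" for m
    using assms(1) by (rule grid_max_measurable)
qed

text \<open>The first maximum time is at most \<open>c\<close> iff the maximum over \<open>[a, b]\<close> is already attained on \<open>[a, c]\<close>.\<close>

lemma first_max_measurable:
  assumes X: "continuous_process M X" and ab: "a \<le> b"
  shows "(\<lambda>x. first_max (X x) a b) \<in> borel_measurable M"
  unfolding borel_measurable_iff_le
proof
  fix c :: real
  note c = X[unfolded continuous_process_def, THEN conjunct1, rule_format]
  have "{x \<in> space M. first_max (X x) a b \<le> c} =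
    (if c < a then {} else if b \<le> c then space M
     else {x \<in> space M. maxval (X x) a c = maxval (X x) a b})"
  proof -
    have "first_max (X x) a b \<le> c \<longleftrightarrow> maxval (X x) a c = maxval (X x) a b"
      if x: "x \<in> space M" and cc: "a \<le> c" "c < b" for x
    proof
      assume le: "first_max (X x) a b \<le> c"
      have "maxval (X x) a b \<le> maxval (X x) a c"
        using maxval_upper[OF c[OF x], of "first_max (X x) a b" a c] le
          first_max_props(1,2)[OF c[OF x] ab] by auto
      moreover have "maxval (X x) a c \<le> maxval (X x) a b"
        unfolding maxval_le_iff[OF c[OF x] cc(1)] using cc(2)
        by (intro ballI maxval_upper[OF c[OF x]]) auto
      ultimately show "maxval (X x) a c = maxval (X x) a b" by simp
    next
      assume eq: "maxval (X x) a c = maxval (X x) a b"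
      obtain t where "t \<in> {a..c}" "X x t = maxval (X x) a c"
        using maxval_attained[OF c[OF x] cc(1)] by auto
      then show "first_max (X x) a b \<le> c"
        using first_max_props(3)[OF c[OF x] ab, of t] eq cc by auto
    qed
    moreover have "first_max (X x) a b \<in> {a..b}" if "x \<in> space M" for x
      using first_max_props(1)[OF c[OF that] ab] .
    ultimately show ?thesis by force
  qed
  moreover have "{x \<in> space M. maxval (X x) a c = maxval (X x) a b} \<in> sets M" if "a \<le> c"
    using maxval_measurable[OF X that] maxval_measurable[OF X ab] by measurable
  ultimately show "{x \<in> space M. first_max (X x) a b \<le> c} \<in> sets M" by auto
qed

lemma last_max_measurable:
  assumes X: "continuous_process M X" and ab: "a \<le> b"
  shows "(\<lambda>x. last_max (X x) a b) \<in> borel_measurable M"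
proof -
  have "continuous_process M (\<lambda>x t. X x (- t))"
    using X unfolding continuous_process_def
    by (auto intro!: continuous_on_compose2[of UNIV _ UNIV uminus] continuous_on_minus continuous_on_id)
  then show ?thesis
    unfolding last_max_def using ab by (intro borel_measurable_uminus first_max_measurable) auto
qed

text \<open>A non-measurable set would be given measure \<open>0\<close>, so the event in the theorem has to be shown measurable.\<close>

lemma same_maximizer_measurable:
  assumes X: "continuous_process M X" and Y: "continuous_process M Y"
  shows "{x \<in> space M. maximizer (X x) = maximizer (Y x)} \<in> sets M"
proof -
  note m = first_max_measurable last_max_measurable
  have n: "- 1 / real (Suc n) \<le> 0" "1 \<le> 1 + 1 / real (Suc n)" for n by simp_all
  define D where "D \<omega> \<longleftrightarrow> first_max \<omega> 0 1 = last_max \<omega> 0 1 \<and>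
        (first_max \<omega> 0 1 \<noteq> 0 \<or> (\<exists>n. first_max \<omega> (- 1 / real (Suc n)) 0 = 0)) \<and>
        (first_max \<omega> 0 1 \<noteq> 1 \<or> (\<exists>n. last_max \<omega> 1 (1 + 1 / real (Suc n)) = 1))" for \<omega>
  have eq: "maximizer \<omega> = (if D \<omega> then Some (first_max \<omega> 0 1) else None)"
    if "continuous_on UNIV \<omega>" for \<omega>
    using maximizer_eq[OF that] unfolding D_def .
  have D[measurable]: "Measurable.pred M (\<lambda>x. D (Z x))" if Z: "continuous_process M Z" for Z
  proof -
    have [measurable]: "(\<lambda>x. first_max (Z x) 0 1) \<in> borel_measurable M"
      "(\<lambda>x. last_max (Z x) 0 1) \<in> borel_measurable M"
      "\<And>n. (\<lambda>x. first_max (Z x) (- 1 / real (Suc n)) 0) \<in> borel_measurable M"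
      "\<And>n. (\<lambda>x. last_max (Z x) 1 (1 + 1 / real (Suc n))) \<in> borel_measurable M"
      using m[OF Z] n by auto
    show ?thesis unfolding D_def by measurable
  qed
  have [measurable]: "(\<lambda>x. first_max (X x) 0 1) \<in> borel_measurable M"
    "(\<lambda>x. first_max (Y x) 0 1) \<in> borel_measurable M"
    using m[OF X] m[OF Y] by auto
  have [measurable]: "Measurable.pred M (\<lambda>x. D (X x))" "Measurable.pred M (\<lambda>x. D (Y x))"
    using D X Y by auto
  have "{x \<in> space M. maximizer (X x) = maximizer (Y x)} =
    {x \<in> space M. D (X x) \<and> D (Y x) \<and> first_max (X x) 0 1 = first_max (Y x) 0 1 \<or>
       \<not> D (X x) \<and> \<not> D (Y x)}"
    using X Y unfolding continuous_process_def by (auto simp: eq split: if_splits)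
  also have "\<dots> \<in> sets M" by measurable
  finally show ?thesis .
qed



section \<open>Limits of events\<close>

context prob_space
begin

text \<open>All the small constants of the construction are chosen by this: an event that almost surely fails
  from some index on has small probability for some index.\<close>

lemma prob_small:
  assumes A: "\<And>n. A n \<in> events"
    and ev: "AE x in M. eventually (\<lambda>n. x \<notin> A n) sequentially"
    and e: "e > 0"
  shows "\<exists>n :: nat. prob (A n) < e"
proof -
  define C where "C n = (\<Union>k\<in>{n..}. A k)" for n
  have C: "C n \<in> events" for n unfolding C_def using A by auto
  have "(\<lambda>n. prob (C n)) \<longlonglongrightarrow> prob (\<Inter>n. C n)"
    using C by (intro finite_Lim_measure_decseq) (auto simp: decseq_def C_def intro: order_trans)
  moreover have "prob (\<Inter>n. C n) = 0"
  proof (intro measure_eq_0_null_sets AE_iff_null_sets[THEN iffD2])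
    show "(\<Inter>n. C n) \<in> events" using C by auto
    show "AE x in M. x \<notin> (\<Inter>n. C n)"
      using ev by eventually_elim (auto simp: C_def eventually_sequentially)
  qed
  ultimately have "(\<lambda>n. prob (C n)) \<longlonglongrightarrow> 0" by simp
  then have "eventually (\<lambda>n. prob (C n) < e) sequentially"
    using e by (rule order_tendstoD)
  then obtain n where n: "prob (C n) < e" by (auto simp: eventually_sequentially)
  have "prob (A n) \<le> prob (C n)"
    using C A by (intro finite_measure_mono) (auto simp: C_def)
  with n show ?thesis by (intro exI[of _ n]) simp
qed

text \<open>Fatou for events: an estimate that is uniform along an approximating sequence passes to the limit.
  It transfers estimates from grid maxima to maxima.\<close>

lemma prob_le_of_eventually:
  assumes A: "\<And>n. A n \<in> events" "\<And>n :: nat. prob (A n) \<le> c" and S: "S \<in> events"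
    and ev: "\<And>x. x \<in> S \<Longrightarrow> eventually (\<lambda>n. x \<in> A n) sequentially"
  shows "prob S \<le> c"
proof (rule field_le_epsilon)
  fix e :: real assume e: "0 < e"
  have "\<exists>n. prob (S - A n) < e"
  proof (rule prob_small)
    show "AE x in M. \<forall>\<^sub>F n in sequentially. x \<notin> S - A n"
    proof (rule AE_I2)
      fix x
      show "\<forall>\<^sub>F n in sequentially. x \<notin> S - A n"
        using ev[of x] by (cases "x \<in> S") (auto elim: eventually_mono)
    qed
  qed (use A S e in auto)
  then obtain n where "prob (S - A n) < e" by blast
  moreover have "prob S \<le> prob (A n \<union> (S - A n))"
    using A(1) S by (intro finite_measure_mono) auto
  moreover have "prob (A n \<union> (S - A n)) \<le> prob (A n) + prob (S - A n)"
    using A(1) S by (intro measure_Un_le) auto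
  ultimately show "prob S \<le> c + e" using A(2)[of n] by linarith
qed

text \<open>By independence, \<open>Y\<close> may be frozen; an interval of length \<open>2 e\<close> has mass at most \<open>2 C e\<close>
  for a density bounded by \<open>C\<close>.\<close>

lemma prob_close_le:
  assumes ind: "indep_var borel X borel (Y :: 'a \<Rightarrow> real)"
    and D: "distributed M lborel X f" and f: "\<And>x. f x \<le> ennreal C" and C: "C \<ge> 0" and e: "e > 0"
  shows "prob {x \<in> space M. \<bar>X x - Y x\<bar> < e} \<le> 2 * C * e"
proof -
  have X[measurable]: "X \<in> borel_measurable M" and Y[measurable]: "Y \<in> borel_measurable M"
    using indep_var_rv1[OF ind] indep_var_rv2[OF ind] by auto
  have dX: "distr M borel X = density lborel f"
    using D unfolding distributed_def by (metis (no_types) distr_cong sets_lborel)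
  interpret X: prob_space "distr M borel X" by (rule prob_space_distr) simp
  interpret Y: prob_space "distr M borel Y" by (rule prob_space_distr) simp
  interpret XY: pair_sigma_finite "distr M borel X" "distr M borel Y" ..
  let ?S = "{p. \<bar>fst p - snd p\<bar> < e} :: (real \<times> real) set"
  have "{p \<in> space (borel \<Otimes>\<^sub>M borel). \<bar>fst p - snd p\<bar> < e} \<in> sets (borel \<Otimes>\<^sub>M (borel :: real measure))"
    by measurable
  then have S[measurable]: "?S \<in> sets (borel \<Otimes>\<^sub>M borel)" by (simp add: space_pair_measure)
  have f_meas[measurable]: "f \<in> borel_measurable lborel"
    using D unfolding distributed_def by auto
  have sec: "emeasure (distr M borel X) ((\<lambda>x. (x, y)) -` ?S) \<le> ennreal (2 * C * e)" for y
  proof -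
    have eq: "(\<lambda>x. (x, y)) -` ?S = {y - e<..<y + e}" by (auto simp: space_pair_measure)
    have "emeasure (distr M borel X) ((\<lambda>x. (x, y)) -` ?S) =
        (\<integral>\<^sup>+ x. f x * indicator {y - e<..<y + e} x \<partial>lborel)"
      unfolding eq dX by (subst emeasure_density) auto
    also have "\<dots> \<le> (\<integral>\<^sup>+ x. ennreal C * indicator {y - e<..<y + e} x \<partial>lborel)"
      using f by (intro nn_integral_mono mult_right_mono) auto
    also have "\<dots> = ennreal C * ennreal (2 * e)"
      using e by (subst nn_integral_cmult_indicator) auto
    also have "\<dots> = ennreal (2 * C * e)"
      using C e by (subst ennreal_mult[symmetric]) (auto simp: ac_simps)
    finally show ?thesis .
  qed
  have "emeasure M {x \<in> space M. \<bar>X x - Y x\<bar> < e} =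
      emeasure (distr M (borel \<Otimes>\<^sub>M borel) (\<lambda>x. (X x, Y x))) ?S"
    using S by (subst emeasure_distr) (auto intro!: arg_cong[where f="emeasure M"])
  also have "\<dots> = emeasure (distr M borel X \<Otimes>\<^sub>M distr M borel Y) ?S"
    using ind unfolding indep_var_distribution_eq by simp
  also have "\<dots> = (\<integral>\<^sup>+ y. emeasure (distr M borel X) ((\<lambda>x. (x, y)) -` ?S) \<partial>distr M borel Y)"
    using S by (intro XY.emeasure_pair_measure_alt2) auto
  also have "\<dots> \<le> (\<integral>\<^sup>+ y. ennreal (2 * C * e) \<partial>distr M borel Y)"
    using sec by (intro nn_integral_mono) auto
  also have "\<dots> = ennreal (2 * C * e)" using Y.emeasure_space_1 by simp
  finally show ?thesis using C e by (simp add: emeasure_eq_measure)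
qed

end

section \<open>Brownian motion\<close>

locale brownian = prob_space M for M :: "'a measure" +
  fixes B :: "'a \<Rightarrow> real \<Rightarrow> real"
  assumes bm: "two_sided_brownian_motion M B"
begin

lemma continuous_process: "continuous_process M B"
  using bm unfolding two_sided_brownian_motion_def continuous_process_def by auto

lemma path_continuous: "x \<in> space M \<Longrightarrow> continuous_on UNIV (B x)"
  using continuous_process unfolding continuous_process_def by auto

lemma path_0: "x \<in> space M \<Longrightarrow> B x 0 = 0"
  using bm unfolding two_sided_brownian_motion_def by auto

lemma coord[measurable]: "(\<lambda>x. B x t) \<in> borel_measurable M"
  using continuous_process unfolding continuous_process_def by auto

lemma increment_distributed:
  "s < t \<Longrightarrow> distributed M lborel (\<lambda>x. B x t - B x s) (normal_density 0 (sqrt (t - s)))"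
  using bm unfolding two_sided_brownian_motion_def by auto

lemma increments_indep:
  fixes n :: nat
  shows "strict_mono_on {..n} u \<Longrightarrow>
     indep_vars (\<lambda>_. borel) (\<lambda>i x. B x (u (Suc i)) - B x (u i)) {..<n}"
  using bm unfolding two_sided_brownian_motion_def by auto

lemma increment_prob_pos:
  assumes st: "s < t" and S: "S \<in> sets borel" "{u<..<v} \<subseteq> S" "u < v"
  shows "prob {x \<in> space M. B x t - B x s \<in> S} > 0"
proof (rule ccontr)
  let ?X = "\<lambda>x. B x t - B x s" and ?f = "\<lambda>x. ennreal (normal_density 0 (sqrt (t - s)) x)"
  assume "\<not> ?thesis"
  then have z: "prob {x \<in> space M. ?X x \<in> S} = 0"
    by (simp add: not_less measure_le_0_iff)
  note D = increment_distributed[OF st]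
  have "(\<integral>\<^sup>+ x. ?f x * indicator S x \<partial>lborel) = emeasure M (?X -` S \<inter> space M)"
    using distributed_emeasure[OF D, of S] S by simp
  also have "\<dots> = 0"
    using z by (simp add: emeasure_eq_measure vimage_def Int_def conj_commute)
  finally have "AE x in lborel. ?f x * indicator S x = 0"
    using S by (subst (asm) nn_integral_0_iff_AE) auto
  then have "AE x in lborel. x \<notin> S"
    using normal_density_pos[of "sqrt (t - s)" 0] st
    by (auto elim!: eventually_mono simp: indicator_def less_le split: if_splits)
  then have "S \<in> null_sets lborel" using S by (subst AE_iff_null_sets) auto
  then have "emeasure lborel {u<..<v} = 0"
    using null_sets_subset[of S lborel "{u<..<v}"] S by auto
  with S show False by simp
qed

text \<open>The increment over \<open>[q, r]\<close> is independent of all that happens before \<open>q\<close>, relative to the value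
  at \<open>q\<close>, and after \<open>r\<close>, relative to the value at \<open>r\<close>. The points of both grids are arranged in one
  increasing sequence \<open>u\<close>; one of its increments is the increment over \<open>[q, r]\<close>, and the grid maxima
  are functions \<open>G\<close> of the others.\<close>

lemma increment_indep_of_grids:
  fixes H :: "real \<times> real \<times> real \<Rightarrow> real"
  assumes "a < q" "q < r" "r < b" and H: "H \<in> borel_measurable (borel \<Otimes>\<^sub>M (borel \<Otimes>\<^sub>M borel))"
  shows "indep_var borel (\<lambda>x. B x r - B x q) borel
    (\<lambda>x. H (B x a - B x q, grid_max (\<lambda>t. B x t - B x q) a q m, grid_max (\<lambda>t. B x t - B x r) r b m))"
proof -
  define N where "N = Suc m"
  have N: "N > 0" by (simp add: N_def)
  define u where "u j = (if j \<le> N then a + (q - a) * real j / real N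
     else r + (b - r) * real (j - Suc N) / real N)" for j
  have uq: "u N = q" and ua: "u 0 = a" and ur: "u (Suc N) = r" using N by (auto simp: u_def)
  have u_le: "u j \<le> q" if "j \<le> N" for j
  proof -
    have "(q - a) * (real j / real N) \<le> (q - a) * 1"
      using that N assms by (intro mult_left_mono) auto
    then show ?thesis using that by (simp add: u_def)
  qed
  have u_ge: "u j \<ge> r" if "N < j" for j using that assms by (simp add: u_def)
  have mono: "strict_mono_on {..2 * N + 1} u"
  proof (rule strict_mono_onI)
    fix i j assume "i \<in> {..2 * N + 1}" "j \<in> {..2 * N + 1}" and ij: "i < j"
    consider "j \<le> N" | "i \<le> N" "N < j" | "N < i" by linarith
    then show "u i < u j"
    proof cases
      case 1
      then show ?thesis using ij assms N
        by (simp add: u_def divide_strict_right_mono)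
    next
      case 2
      then show ?thesis using u_le[of i] u_ge[of j] assms by linarith
    next
      case 3
      then have "real (i - Suc N) < real (j - Suc N)" using ij by simp
      then show ?thesis using 3 ij assms N
        by (simp add: u_def divide_strict_right_mono)
    qed
  qed
  define D where "D j x = B x (u (Suc j)) - B x (u j)" for j x
  let ?I = "{..<2 * N + 1}"
  have ind: "indep_vars (\<lambda>_. borel) D ?I"
    unfolding D_def[abs_def] by (rule increments_indep[OF mono])
  define G where "G d = (- (\<Sum>j=0..<N. d j), Max ((\<lambda>i. - (\<Sum>j=i..<N. d j)) ` {..N}),
     Max ((\<lambda>i. \<Sum>j=Suc N..<Suc N + i. d j) ` {..N}))" for d :: "nat \<Rightarrow> real"
  have comp: "(\<lambda>d. d j) \<in> borel_measurable (PiM (?I - {N}) (\<lambda>_. borel))" if "j \<in> ?I - {N}" for j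
    using that by (rule measurable_component_singleton)
  have G: "G \<in> PiM (?I - {N}) (\<lambda>_. borel) \<rightarrow>\<^sub>M borel \<Otimes>\<^sub>M (borel \<Otimes>\<^sub>M borel)"
    unfolding G_def
    by (intro measurable_Pair borel_measurable_uminus borel_measurable_sum borel_measurable_Max comp) auto
  have "indep_var borel ((\<lambda>d. d N) \<circ> (\<lambda>x. restrict (\<lambda>i. D i x) {N})) borel
     ((H \<circ> G) \<circ> (\<lambda>x. restrict (\<lambda>i. D i x) (?I - {N})))"
    using measurable_comp[OF G H] by (intro indep_var_compose[OF indep_var_restrict[OF ind]]) auto
  moreover have "(\<lambda>d. d N) \<circ> (\<lambda>x. restrict (\<lambda>i. D i x) {N}) = (\<lambda>x. B x r - B x q)"
    by (simp add: D_def fun_eq_iff uq ur)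
  moreover have "G \<circ> (\<lambda>x. restrict (\<lambda>i. D i x) (?I - {N})) =
    (\<lambda>x. (B x a - B x q, grid_max (\<lambda>t. B x t - B x q) a q m, grid_max (\<lambda>t. B x t - B x r) r b m))"
  proof
    fix x
    let ?d = "restrict (\<lambda>i. D i x) (?I - {N})"
    have left: "- (\<Sum>j=i..<N. ?d j) = B x (u i) - B x q" if "i \<le> N" for i
    proof -
      have "(\<Sum>j=i..<N. ?d j) = (\<Sum>j=i..<N. B x (u (Suc j)) - B x (u j))"
        by (intro sum.cong) (auto simp: D_def)
      also have "\<dots> = B x (u N) - B x (u i)" by (rule sum_Suc_diff'[OF that])
      finally show ?thesis using uq by simp
    qed
    have right: "(\<Sum>j=Suc N..<Suc N + i. ?d j) = B x (u (Suc N + i)) - B x r" if "i \<le> N" for i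
    proof -
      have "(\<Sum>j=Suc N..<Suc N + i. ?d j) = (\<Sum>j=Suc N..<Suc N + i. B x (u (Suc j)) - B x (u j))"
        using that by (intro sum.cong) (auto simp: D_def)
      also have "\<dots> = B x (u (Suc N + i)) - B x (u (Suc N))" by (rule sum_Suc_diff') simp
      finally show ?thesis using ur by simp
    qed
    have 1: "(\<lambda>i. - (\<Sum>j=i..<N. ?d j)) ` {..N} = (\<lambda>i. B x (a + (q - a) * real i / real N) - B x q) ` {..N}"
      using left by (intro image_cong) (auto simp: u_def)
    have 2: "(\<lambda>i. \<Sum>j=Suc N..<Suc N + i. ?d j) ` {..N} = (\<lambda>i. B x (r + (b - r) * real i / real N) - B x r) ` {..N}"
      using right by (intro image_cong) (auto simp: u_def)
    show "(G \<circ> (\<lambda>x. restrict (\<lambda>i. D i x) (?I - {N}))) x =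
      (B x a - B x q, grid_max (\<lambda>t. B x t - B x q) a q m, grid_max (\<lambda>t. B x t - B x r) r b m)"
      unfolding o_def G_def grid_max_def 1 2 N_def[symmetric] using left[of 0] ua by simp
  qed
  ultimately show ?thesis by (simp add: comp_assoc) (simp add: o_def)
qed

text \<open>The two maxima agree only if the increment \<open>X\<close> over \<open>[q, r]\<close> equals a quantity \<open>Y\<close> built from the
  path before \<open>q\<close> and after \<open>r\<close>. The grid versions \<open>Z m\<close> of \<open>Y\<close> are independent of \<open>X\<close>, and \<open>X\<close> has a
  bounded density, so \<open>X\<close> and \<open>Z m\<close> are \<open>e\<close>-close with probability \<open>O(e)\<close>, uniformly in \<open>m\<close>.\<close>

lemma maxima_differ:
  assumes "a < q" "q < r" "r < b"
  shows "AE x in M. maxval (B x) a q \<noteq> maxval (B x) r b"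
proof -
  define X where "X x = B x r - B x q" for x
  define Y where "Y x = maxval (\<lambda>t. B x t - B x q) a q - maxval (\<lambda>t. B x t - B x r) r b" for x
  define Z where "Z m x = grid_max (\<lambda>t. B x t - B x q) a q m - grid_max (\<lambda>t. B x t - B x r) r b m" for m x
  have cp: "continuous_process M (\<lambda>x t. B x t - B x s)" for s
    using path_continuous unfolding continuous_process_def by (auto intro!: continuous_intros)
  have cont: "continuous_on UNIV (\<lambda>t. B x t - B x s)" if "x \<in> space M" for x s
    using cp that unfolding continuous_process_def by auto
  have Y[measurable]: "Y \<in> borel_measurable M"
    unfolding Y_def[abs_def] using assms by (intro borel_measurable_diff maxval_measurable cp) auto
  have X[measurable]: "X \<in> borel_measurable M" unfolding X_def[abs_def] by measurable
  have ind: "indep_var borel X borel (Z m)" for m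
  proof -
    have "(\<lambda>p. fst (snd p) - snd (snd p)) \<in> borel_measurable (borel \<Otimes>\<^sub>M (borel \<Otimes>\<^sub>M (borel :: real measure)))"
      by measurable
    from increment_indep_of_grids[OF assms this, of m] show ?thesis
      by (simp add: X_def[abs_def] Z_def[abs_def])
  qed
  then have Z[measurable]: "Z m \<in> borel_measurable M" for m using indep_var_rv2 by blast
  have lim: "(\<lambda>m. Z m x) \<longlonglongrightarrow> Y x" if "x \<in> space M" for x
    unfolding Z_def Y_def using cont[OF that] assms by (intro tendsto_diff grid_max_tendsto) auto
  define C where "C = 1 / sqrt (2 * pi * (r - q))"
  have C: "C \<ge> 0" using assms by (simp add: C_def)
  have dens: "ennreal (normal_density 0 (sqrt (r - q)) x) \<le> ennreal C" for x
    using assms unfolding normal_density_def C_def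
    by (intro ennreal_leI) (auto intro!: divide_right_mono simp: field_simps)
  have "prob {x \<in> space M. X x = Y x} \<le> 2 * C * e" if e: "e > 0" for e
  proof (rule prob_le_of_eventually)
    show "{x \<in> space M. \<bar>X x - Z m x\<bar> < e} \<in> events" for m by measurable
    show "prob {x \<in> space M. \<bar>X x - Z m x\<bar> < e} \<le> 2 * C * e" for m
      using assms X_def dens C e
      by (intro prob_close_le[OF ind increment_distributed[OF assms(2), folded X_def]]) auto
    show "{x \<in> space M. X x = Y x} \<in> events" by measurable
    show "\<forall>\<^sub>F m in sequentially. x \<in> {x \<in> space M. \<bar>X x - Z m x\<bar> < e}"
      if "x \<in> {x \<in> space M. X x = Y x}" for x
      using tendstoD[OF lim e] that by (auto simp: dist_real_def abs_minus_commute)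
  qed
  then have "prob {x \<in> space M. X x = Y x} \<le> 0 + e" if "e > 0" for e
  proof -
    have "2 * C * (e / (2 * C + 1)) \<le> e" using C that by (simp add: field_simps)
    moreover have "e / (2 * C + 1) > 0" using C that by simp
    ultimately show ?thesis
      using \<open>\<And>e. e > 0 \<Longrightarrow> prob {x \<in> space M. X x = Y x} \<le> 2 * C * e\<close>[of "e / (2 * C + 1)"] by linarith
  qed
  then have "prob {x \<in> space M. X x = Y x} \<le> 0" by (rule field_le_epsilon)
  then have "AE x in M. X x \<noteq> Y x"
    by (subst prob_Collect_eq_0[symmetric]) (auto simp: measure_le_0_iff)
  then show ?thesis
  proof (rule AE_mp, intro AE_I2 impI)
    fix x assume x: "x \<in> space M" "X x \<noteq> Y x"
    then show "maxval (B x) a q \<noteq> maxval (B x) r b"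
      using maxval_shift[OF path_continuous[OF x(1)], of a q "B x q"]
        maxval_shift[OF path_continuous[OF x(1)], of r b "B x r"] assms
      unfolding X_def Y_def by auto
  qed
qed

text \<open>Two different maximum times can be separated by two rationals, and the maxima to the left and to
  the right of them would agree.\<close>

lemma unique_maximum: "AE x in M. first_max (B x) 0 1 = last_max (B x) 0 1"
proof -
  have "AE x in M. \<forall>q r :: rat. 0 < (of_rat q :: real) \<and> q < r \<and> of_rat r < (1 :: real) \<longrightarrow>
      maxval (B x) 0 (of_rat q) \<noteq> maxval (B x) (of_rat r) 1"
    unfolding AE_all_countable 
    by (intro allI AE_impI maxima_differ) (auto simp: of_rat_less)
  then show ?thesis
  proof (rule AE_mp, intro AE_I2 impI)
    fix x assume x: "x \<in> space M" and *: "\<forall>q r :: rat. 0 < (of_rat q :: real) \<and> q < r \<and> of_rat r < (1 :: real) \<longrightarrow>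
      maxval (B x) 0 (of_rat q) \<noteq> maxval (B x) (of_rat r) 1"
    note c = path_continuous[OF x]
    let ?s = "first_max (B x) 0 1" and ?t = "last_max (B x) 0 1"
    have 01: "(0::real) \<le> 1" by simp
    note f = first_max_props(1,2)[OF c 01] and l = last_max_props(1,2)[OF c 01]
    have le: "?s \<le> ?t" using first_max_props(3)[OF c 01 l] .
    show "?s = ?t"
    proof (rule ccontr)
      assume "?s \<noteq> ?t"
      then have st: "?s < ?t" using le by simp
      obtain q0 where "?s < of_rat q0" "of_rat q0 < ?t" using of_rat_dense[OF st] by blast
      then obtain q where q: "q = of_rat q0" "?s < q" "q < ?t" by blast
      obtain r0 where "q < of_rat r0" "of_rat r0 < ?t" using of_rat_dense[OF q(3)] by blast
      then obtain r where r: "r = of_rat r0" "q < r" "r < ?t" by blast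
      have "q0 < r0" using r(2) q(1) r(1) by (simp add: of_rat_less)
      moreover have "0 < q" "r < 1" using f(1) l(1) q(2) r(3) by auto
      ultimately have "maxval (B x) 0 q \<noteq> maxval (B x) r 1"
        using *[rule_format, of q0 r0] unfolding q(1) r(1) by blast
      moreover have "maxval (B x) 0 q = maxval (B x) 0 1"
      proof (rule antisym)
        show "maxval (B x) 0 q \<le> maxval (B x) 0 1"
          using f(1) l(1) q(2,3) by (intro maxval_mono[OF c]) auto
        show "maxval (B x) 0 1 \<le> maxval (B x) 0 q"
          using maxval_upper[OF c, of ?s 0 q] f q(2) by auto
      qed
      moreover have "maxval (B x) r 1 = maxval (B x) 0 1"
      proof (rule antisym)
        show "maxval (B x) r 1 \<le> maxval (B x) 0 1"
          using f(1) l(1) q(2,3) r(2,3) by (intro maxval_mono[OF c]) auto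
        show "maxval (B x) 0 1 \<le> maxval (B x) r 1"
          using maxval_upper[OF c, of ?t r 1] l r(3) by auto
      qed
      ultimately show False by simp
    qed
  qed
qed

lemma maxval_bounded_prob:
  assumes "a \<le> b" "e > 0"
  shows "\<exists>c \<ge> 0. prob {x \<in> space M. maxval (\<lambda>t. B x t - B x s) a b > c} < e"
proof -
  have cp: "continuous_process M (\<lambda>x t. B x t - B x s)"
    using path_continuous unfolding continuous_process_def by (auto intro!: continuous_intros)
  have [measurable]: "(\<lambda>x. maxval (\<lambda>t. B x t - B x s) a b) \<in> borel_measurable M"
    using maxval_measurable[OF cp assms(1)] .
  have "\<exists>n. prob {x \<in> space M. maxval (\<lambda>t. B x t - B x s) a b > real n} < e"
  proof (rule prob_small)
    show "AE x in M. \<forall>\<^sub>F n in sequentially. x \<notin> {x \<in> space M. maxval (\<lambda>t. B x t - B x s) a b > real n}"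
    proof (rule AE_I2)
      fix x
      obtain n where "maxval (\<lambda>t. B x t - B x s) a b \<le> real n" using real_arch_simple by blast
      then show "\<forall>\<^sub>F n in sequentially. x \<notin> {x \<in> space M. maxval (\<lambda>t. B x t - B x s) a b > real n}"
        by (intro eventually_sequentiallyI[of n]) (auto simp: not_less)
    qed
  qed (use assms in auto)
  then obtain n where "prob {x \<in> space M. maxval (\<lambda>t. B x t - B x s) a b > real n} < e" by blast
  then show ?thesis by (intro exI[of _ "real n"]) simp
qed

text \<open>The path stays below some level \<open>B a + c2\<close> after time \<open>a\<close> with large probability, and
  independently of this it falls by more than \<open>K = c2 + c\<close> during \<open>[a / 2, a]\<close> with positive
  probability, since the normal density is positive everywhere. Then it stays below
  \<open>B (a / 2) - c\<close>. The condition \<open>0 < B (a / 2)\<close> excludes \<open>0\<close> as a maximum time.\<close>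

lemma descent_prob_pos:
  assumes a: "0 < a" "a < 1"
  shows "prob {x \<in> space M. 0 < B x (a / 2) \<and> maxval (B x) a 1 \<le> B x (a / 2) - c} > 0"
proof -
  let ?q = "a / 2"
  let ?R = "\<lambda>x. maxval (\<lambda>t. B x t - B x a) a 1"
  let ?Rm = "\<lambda>m x. grid_max (\<lambda>t. B x t - B x a) a 1 m"
  have cp: "continuous_process M (\<lambda>x t. B x t - B x s)" for s
    using path_continuous unfolding continuous_process_def by (auto intro!: continuous_intros)
  have cont: "continuous_on UNIV (\<lambda>t. B x t - B x s)" if "x \<in> space M" for x s
    using cp that unfolding continuous_process_def by auto
  have R[measurable]: "?R \<in> borel_measurable M" using maxval_measurable[OF cp] a by auto
  have [measurable]: "(\<lambda>x. maxval (B x) a 1) \<in> borel_measurable M"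
    using maxval_measurable[OF continuous_process] a by auto
  have ordered: "0 < ?q" "?q < a" "a < 1" using a by auto
  have Rm[measurable]: "?Rm m \<in> borel_measurable M" for m using grid_max_measurable[OF cp] .
  define p1 where "p1 = prob {x \<in> space M. B x 0 - B x ?q < 0}"
  have "{x \<in> space M. B x 0 - B x ?q < 0} = {x \<in> space M. B x ?q - B x 0 \<in> {0<..}}" by auto
  then have p1: "p1 > 0"
    unfolding p1_def using a increment_prob_pos[of 0 ?q "{0<..}" 0 1] by (simp add: subset_iff)
  obtain c2 where c2: "prob {x \<in> space M. ?R x > c2} < p1"
    using maxval_bounded_prob[of a 1 p1 a] p1 a by auto
  define p2 where "p2 = prob {x \<in> space M. B x 0 - B x ?q < 0 \<and> ?R x \<le> c2}"
  have "p1 \<le> prob ({x \<in> space M. B x 0 - B x ?q < 0 \<and> ?R x \<le> c2} \<union> {x \<in> space M. ?R x > c2})"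
    unfolding p1_def by (intro finite_measure_mono) auto
  also have "\<dots> \<le> p2 + prob {x \<in> space M. ?R x > c2}"
    unfolding p2_def by (intro measure_Un_le) auto
  finally have p2: "p2 > 0" using c2 by linarith
  define K where "K = c2 + c"
  define p3 where "p3 = prob {x \<in> space M. B x a - B x ?q \<in> {..< - K}}"
  have p3: "p3 > 0" unfolding p3_def using a
    by (intro increment_prob_pos[of _ _ _ "- K - 1" "- K"]) auto
  let ?A = "\<lambda>m. {x \<in> space M. B x a - B x ?q < - K \<and> B x 0 - B x ?q < 0 \<and> ?Rm m x \<le> c2}"
  let ?S = "{x \<in> space M. B x a - B x ?q < - K \<and> B x 0 - B x ?q < 0 \<and> ?R x \<le> c2}"
  have A: "prob (?A m) \<ge> p3 * p2" for m
  proof -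
    let ?H = "\<lambda>p :: real \<times> real \<times> real. of_bool (fst p < 0 \<and> snd (snd p) \<le> c2) :: real"
    let ?V = "\<lambda>x. ?H (B x 0 - B x ?q, grid_max (\<lambda>t. B x t - B x ?q) 0 ?q m, ?Rm m x)"
    have H: "?H \<in> borel_measurable (borel \<Otimes>\<^sub>M (borel \<Otimes>\<^sub>M borel))" by measurable
    note ind = increment_indep_of_grids[OF ordered H, of m]
    have "prob ((\<lambda>x. (B x a - B x ?q, ?V x)) -` ({..< - K} \<times> {1}) \<inter> space M) =
      prob ((\<lambda>x. B x a - B x ?q) -` {..< - K} \<inter> space M) * prob (?V -` {1} \<inter> space M)"
      by (intro indep_varD[OF ind]) auto
    moreover have "(\<lambda>x. (B x a - B x ?q, ?V x)) -` ({..< - K} \<times> {1}) \<inter> space M = ?A m"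
      by auto
    moreover have "prob ((\<lambda>x. B x a - B x ?q) -` {..< - K} \<inter> space M) = p3"
      unfolding p3_def by (intro arg_cong[where f=prob]) auto
    moreover have "p2 \<le> prob (?V -` {1} \<inter> space M)"
      unfolding p2_def
    proof (rule finite_measure_mono)
      show "{x \<in> space M. B x 0 - B x ?q < 0 \<and> ?R x \<le> c2} \<subseteq> ?V -` {1} \<inter> space M"
        using order_trans[OF grid_max_le[OF cont]] a by auto
      show "?V -` {1} \<inter> space M \<in> events"
        by (rule measurable_sets[OF indep_var_rv2[OF ind]]) simp
    qed
    ultimately show ?thesis using p3 by (simp add: mult_left_mono)
  qed
  have "prob (space M - ?S) \<le> 1 - p3 * p2"
  proof (rule prob_le_of_eventually)
    show "space M - ?A m \<in> events" for m by measurable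
    show "prob (space M - ?A m) \<le> 1 - p3 * p2" for m
      using A[of m] by (subst prob_compl) auto
    show "space M - ?S \<in> events" by measurable
    show "\<forall>\<^sub>F m in sequentially. x \<in> space M - ?A m" if x: "x \<in> space M - ?S" for x
    proof (cases "?R x \<le> c2")
      case True
      then show ?thesis using x by auto
    next
      case False
      then have "\<forall>\<^sub>F m in sequentially. c2 < ?Rm m x"
        using x a by (intro order_tendstoD(1)[OF grid_max_tendsto[OF cont]]) auto
      then show ?thesis using x by (auto elim: eventually_mono)
    qed
  qed
  moreover have "prob (space M - ?S) = 1 - prob ?S" by (rule prob_compl) measurable
  moreover have "p3 * p2 > 0" using p2 p3 by simp
  ultimately have "0 < prob ?S" by linarith
  also have "\<dots> \<le> prob {x \<in> space M. 0 < B x (a / 2) \<and> maxval (B x) a 1 \<le> B x (a / 2) - c}"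
  proof (rule finite_measure_mono)
    show "?S \<subseteq> {x \<in> space M. 0 < B x (a / 2) \<and> maxval (B x) a 1 \<le> B x (a / 2) - c}"
      using maxval_shift[OF path_continuous, of _ a 1] a path_0 by (auto simp: K_def)
  qed measurable
  finally show ?thesis .
qed

end



text \<open>Being a Brownian motion is a property of the law. Independence of increments transfers because it
  says that the joint law is a product.\<close>

lemma two_sided_brownian_motion_distr:
  assumes Q: "prob_space Q" and p: "p \<in> Q \<rightarrow>\<^sub>M N" and d: "distr Q N p = N"
    and bm: "two_sided_brownian_motion N B"
  shows "two_sided_brownian_motion Q (\<lambda>x. B (p x))"
proof -
  interpret Q: prob_space Q by fact
  interpret N: brownian N B
    using bm unfolding brownian_def brownian_axioms_def two_sided_brownian_motion_def by auto
  have sp: "p x \<in> space N" if "x \<in> space Q" for x using p that by (rule measurable_space)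
  have d': "distr Q K (\<lambda>x. X (p x)) = distr N K X" if "X \<in> N \<rightarrow>\<^sub>M K" for K :: "'d measure" and X
    using distr_distr[OF that p] by (simp add: d o_def)
  have inc: "distributed Q lborel (\<lambda>x. B (p x) t - B (p x) s) (normal_density 0 (sqrt (t - s)))" if "s < t" for s t
  proof -
    have "(\<lambda>y. B y t - B y s) \<in> N \<rightarrow>\<^sub>M lborel" by simp
    moreover from this p have "(\<lambda>x. B (p x) t - B (p x) s) \<in> Q \<rightarrow>\<^sub>M lborel"
      by (rule measurable_compose[rotated])
    ultimately show ?thesis
      using N.increment_distributed[OF that] d'[of "\<lambda>y. B y t - B y s" lborel]
      unfolding distributed_def by simp
  qed
  have ind: "Q.indep_vars (\<lambda>_. borel) (\<lambda>i x. B (p x) (u (Suc i)) - B (p x) (u i)) {..<n}"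
    if "strict_mono_on {..n} u" for n :: nat and u
  proof (cases "n = 0")
    case True
    then show ?thesis by (simp add: Q.indep_vars_def Q.indep_sets_def)
  next
    case False
    let ?D = "\<lambda>i y. B y (u (Suc i)) - B y (u i)"
    have m: "?D i \<in> borel_measurable N" for i by simp
    then have m': "(\<lambda>x. ?D i (p x)) \<in> borel_measurable Q" for i
      using p by (rule measurable_compose[rotated])
    have M: "(\<lambda>y. \<lambda>i\<in>{..<n}. ?D i y) \<in> N \<rightarrow>\<^sub>M PiM {..<n} (\<lambda>_. borel)"
      by (rule measurable_restrict) (rule m)
    have "distr N (PiM {..<n} (\<lambda>_. borel)) (\<lambda>y. \<lambda>i\<in>{..<n}. ?D i y) = PiM {..<n} (\<lambda>i. distr N borel (?D i))"
      using N.increments_indep[OF that] False m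
      by (subst N.indep_vars_iff_distr_eq_PiM[symmetric]) auto
    then have "distr Q (PiM {..<n} (\<lambda>_. borel)) (\<lambda>x. \<lambda>i\<in>{..<n}. ?D i (p x)) =
       PiM {..<n} (\<lambda>i. distr Q borel (\<lambda>x. ?D i (p x)))"
      using d'[OF M] d'[OF m] by simp
    then show ?thesis
      using False m' by (subst Q.indep_vars_iff_distr_eq_PiM) auto
  qed
  have "(\<lambda>x. B (p x) t) \<in> borel_measurable Q" for t
    using p N.coord by (rule measurable_compose)
  then show ?thesis
    unfolding two_sided_brownian_motion_def
    using Q sp N.path_continuous N.path_0 inc ind by blast
qed

section \<open>Wiener integrals of step functions and their limits\<close>

lemma integral_double_sum:
  fixes g :: "'i \<Rightarrow> 'j \<Rightarrow> 'a \<Rightarrow> real"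
  assumes "\<And>i j. i \<in> I \<Longrightarrow> j \<in> J \<Longrightarrow> integrable N (g i j)"
  shows "(\<integral>x. (\<Sum>i\<in>I. \<Sum>j\<in>J. g i j x) \<partial>N) = (\<Sum>i\<in>I. \<Sum>j\<in>J. \<integral>x. g i j x \<partial>N)"
  using assms by (simp add: Bochner_Integration.integral_sum)

lemma step_integral_sum:
  "step_integral l \<beta> = (\<Sum>i<length l. fst (l ! i) * (\<beta> (snd (snd (l ! i))) - \<beta> (fst (snd (l ! i)))))"
  unfolding step_integral_def sum_list_sum_nth
  by (auto simp: case_prod_beta atLeast0LessThan intro!: sum.cong)

lemma step_fun_sum:
  "step_fun l s = (\<Sum>i<length l. fst (l ! i) * indicator {fst (snd (l ! i))<..snd (snd (l ! i))} s)"
  unfolding step_fun_def sum_list_sum_nth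
  by (auto simp: case_prod_beta atLeast0LessThan intro!: sum.cong)

lemma sq_diff_le:
  "ennreal ((a - c)\<^sup>2) \<le> 2 * ennreal ((a - b)\<^sup>2) + 2 * ennreal ((b - c)\<^sup>2)"
proof -
  have "0 \<le> ((a - b) - (b - c))\<^sup>2" by simp
  then have "(a - c)\<^sup>2 \<le> 2 * (a - b)\<^sup>2 + 2 * (b - c)\<^sup>2" by (simp add: power2_eq_square algebra_simps)
  then have "ennreal ((a - c)\<^sup>2) \<le> ennreal (2 * (a - b)\<^sup>2 + 2 * (b - c)\<^sup>2)" by (rule ennreal_leI)
  also have "\<dots> = 2 * ennreal ((a - b)\<^sup>2) + 2 * ennreal ((b - c)\<^sup>2)"
    by (simp add: ennreal_plus ennreal_mult)
  finally show ?thesis .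
qed

definition neg_steps :: "(real \<times> real \<times> real) list \<Rightarrow> (real \<times> real \<times> real) list" where
  "neg_steps l = map (\<lambda>(c, a, b). (- c, a, b)) l"

lemma step_integral_append_neg: "step_integral (l @ neg_steps m) \<beta> = step_integral l \<beta> - step_integral m \<beta>"
  unfolding step_integral_def neg_steps_def
  by (induction m) (auto simp: algebra_simps)

lemma step_fun_append_neg: "step_fun (l @ neg_steps m) s = step_fun l s - step_fun m s"
  unfolding step_fun_def neg_steps_def
  by (induction m) (auto simp: algebra_simps)

lemma step_fun_measurable[measurable]: "step_fun l \<in> borel_measurable lebesgue"
  unfolding step_fun_sum[abs_def]
  by (intro borel_measurable_sum borel_measurable_times borel_measurable_const borel_measurable_indicator) auto

context brownian
begin

lemma increment_square:
  "integrable M (\<lambda>x. (B x t - B x s)\<^sup>2)" "expectation (\<lambda>x. (B x t - B x s)\<^sup>2) = \<bar>t - s\<bar>"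
proof -
  have *: "integrable M (\<lambda>x. (B x t - B x s)\<^sup>2) \<and> expectation (\<lambda>x. (B x t - B x s)\<^sup>2) = t - s"
    if st: "s < t" for s t
  proof
    note D = increment_distributed[OF st]
    show "integrable M (\<lambda>x. (B x t - B x s)\<^sup>2)"
      using distributed_integrable[OF D, of "\<lambda>x. x\<^sup>2"] integrable_normal_moment[of "sqrt (t - s)" 0 2] st
      by simp
    show "expectation (\<lambda>x. (B x t - B x s)\<^sup>2) = t - s"
      using normal_distributed_variance[OF _ D] normal_distributed_expectation[OF _ D] st by simp
  qed
  consider "s < t" | "s = t" | "t < s" by linarith
  then have "integrable M (\<lambda>x. (B x t - B x s)\<^sup>2) \<and> expectation (\<lambda>x. (B x t - B x s)\<^sup>2) = \<bar>t - s\<bar>"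
    using *[of s t] *[of t s] by cases (auto simp: power2_commute[of "B _ t"])
  then show "integrable M (\<lambda>x. (B x t - B x s)\<^sup>2)" "expectation (\<lambda>x. (B x t - B x s)\<^sup>2) = \<bar>t - s\<bar>"
    by auto
qed

text \<open>The product of two increments is a combination of squares of increments, so the covariance is
  determined by the variances alone, without cutting the intervals into disjoint pieces.\<close>

lemma increment_covariance:
  assumes "a \<le> b" "c \<le> d"
  shows "integrable M (\<lambda>x. (B x b - B x a) * (B x d - B x c))"
    "expectation (\<lambda>x. (B x b - B x a) * (B x d - B x c)) = measure lebesgue ({a<..b} \<inter> {c<..d})"
proof -
  have eq: "(B x b - B x a) * (B x d - B x c) = ((B x b - B x c)\<^sup>2 + (B x a - B x d)\<^sup>2 -
      (B x b - B x d)\<^sup>2 - (B x a - B x c)\<^sup>2) / 2" for x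
    by (simp add: power2_eq_square algebra_simps)
  show "integrable M (\<lambda>x. (B x b - B x a) * (B x d - B x c))"
    unfolding eq by (intro integrable_divide_zero Bochner_Integration.integrable_diff
        Bochner_Integration.integrable_add increment_square)
  have "expectation (\<lambda>x. (B x b - B x a) * (B x d - B x c)) = (\<bar>b - c\<bar> + \<bar>a - d\<bar> - \<bar>b - d\<bar> - \<bar>a - c\<bar>) / 2"
    unfolding eq by (simp add: increment_square)
  also have "\<dots> = max 0 (min b d - max a c)"
    using assms by (simp add: min_def max_def abs_if)
  also have "\<dots> = measure lebesgue {max a c<..min b d}"
    by (cases "max a c \<le> min b d") auto
  also have "{max a c<..min b d} = {a<..b} \<inter> {c<..d}" by auto
  finally show "expectation (\<lambda>x. (B x b - B x a) * (B x d - B x c)) = measure lebesgue ({a<..b} \<inter> {c<..d})" .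
qed

lemma step_integral_measurable[measurable]: "(\<lambda>x. step_integral l (B x)) \<in> borel_measurable M"
  unfolding step_integral_sum by measurable

text \<open>Bilinearity reduces the isometry to the covariance of two increments; the intervals in the list
  may overlap.\<close>

lemma wiener_isometry:
  assumes l: "\<forall>(c, a, b)\<in>set l. a \<le> b"
  shows "(\<integral>\<^sup>+ x. ennreal ((step_integral l (B x))\<^sup>2) \<partial>M) = (\<integral>\<^sup>+ s. ennreal ((step_fun l s)\<^sup>2) \<partial>lebesgue)"
proof -
  define c a b where "c i = fst (l ! i)" and "a i = fst (snd (l ! i))" and "b i = snd (snd (l ! i))" for i
  let ?I = "{..<length l}"
  have ab: "a i \<le> b i" if "i \<in> ?I" for i
    using l that nth_mem[of i l] unfolding a_def b_def by (auto simp: case_prod_beta)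
  have 1: "(step_integral l (B x))\<^sup>2 =
      (\<Sum>i\<in>?I. \<Sum>j\<in>?I. c i * c j * ((B x (b i) - B x (a i)) * (B x (b j) - B x (a j))))" for x
    unfolding step_integral_sum power2_eq_square sum_product c_def a_def b_def by (simp add: ac_simps)
  have 2: "(step_fun l s)\<^sup>2 =
      (\<Sum>i\<in>?I. \<Sum>j\<in>?I. c i * c j * indicator ({a i<..b i} \<inter> {a j<..b j}) s)" for s
    unfolding step_fun_sum power2_eq_square sum_product c_def a_def b_def
    by (intro sum.cong refl) (simp only: indicator_inter_arith ac_simps)
  have fin: "emeasure lebesgue ({a i<..b i} \<inter> {a j<..b j}) < \<infinity>" for i j
  proof -
    have "{a i<..b i} \<inter> {a j<..b j} = {max (a i) (a j)<..min (b i) (b j)}" by auto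
    then show ?thesis by (cases "max (a i) (a j) \<le> min (b i) (b j)") (simp_all only: emeasure_lborel_Ioc emeasure_completion, auto)
  qed
  have int1: "integrable M (\<lambda>x. c i * c j * ((B x (b i) - B x (a i)) * (B x (b j) - B x (a j))))"
    if "i \<in> ?I" "j \<in> ?I" for i j
    using increment_covariance(1)[OF ab ab] that by simp
  have int2: "integrable lebesgue (\<lambda>s. c i * c j * indicator ({a i<..b i} \<inter> {a j<..b j}) s)" for i j
    using fin by (intro integrable_mult_right integrable_real_indicator) auto
  have "(\<integral>\<^sup>+ x. ennreal ((step_integral l (B x))\<^sup>2) \<partial>M) = ennreal (expectation (\<lambda>x. (step_integral l (B x))\<^sup>2))"
    unfolding 1 using int1 
    by (intro nn_integral_eq_integral Bochner_Integration.integrable_sum) (auto simp: 1[symmetric])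
  also have "expectation (\<lambda>x. (step_integral l (B x))\<^sup>2) =
     (\<Sum>i\<in>?I. \<Sum>j\<in>?I. c i * c j * measure lebesgue ({a i<..b i} \<inter> {a j<..b j}))"
  proof -
    have "expectation (\<lambda>x. c i * c j * ((B x (b i) - B x (a i)) * (B x (b j) - B x (a j)))) =
        c i * c j * measure lebesgue ({a i<..b i} \<inter> {a j<..b j})" if "i \<in> ?I" "j \<in> ?I" for i j
      using increment_covariance(2)[OF ab ab, OF that] by simp
    then have "(\<Sum>i\<in>?I. \<Sum>j\<in>?I. expectation (\<lambda>x. c i * c j * ((B x (b i) - B x (a i)) * (B x (b j) - B x (a j))))) =
        (\<Sum>i\<in>?I. \<Sum>j\<in>?I. c i * c j * measure lebesgue ({a i<..b i} \<inter> {a j<..b j}))"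
      by (intro sum.cong refl)
    then show ?thesis
      unfolding 1 by (subst integral_double_sum[OF int1])
  qed
  also have "\<dots> = (\<integral>s. (step_fun l s)\<^sup>2 \<partial>lebesgue)"
    unfolding 2 integral_double_sum[OF int2] integral_mult_right_zero integral_indicator by simp
  also have "ennreal \<dots> = (\<integral>\<^sup>+ s. ennreal ((step_fun l s)\<^sup>2) \<partial>lebesgue)"
  proof -
    have "integrable lebesgue (\<lambda>s. (step_fun l s)\<^sup>2)"
      unfolding 2 by (intro Bochner_Integration.integrable_sum int2)
    then show ?thesis by (simp add: nn_integral_eq_integral)
  qed
  finally show ?thesis .
qed

text \<open>By the isometry, integrals of any step functions \<open>m k\<close> converging to \<open>f\<close> in mean square converge to
  \<open>X\<close> in mean square. By Fatou the lower limit of the squared distances vanishes almost surely, so no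
  other pathwise limit is possible. This identifies the integral wherever the step integrals converge
  path by path.\<close>

lemma wiener_integral_eq_limit:
  assumes w: "is_wiener_integral M B f X"
    and m: "\<And>k :: nat. \<forall>(c, a, b)\<in>set (m k). a \<le> b"
    and lim: "(\<lambda>k. \<integral>\<^sup>+ s. ennreal ((f s - step_fun (m k) s)\<^sup>2) \<partial>lebesgue) \<longlonglongrightarrow> 0"
  shows "AE x in M. \<forall>L. (\<lambda>k. step_integral (m k) (B x)) \<longlonglongrightarrow> L \<longrightarrow> X x = L"
proof -
  from w obtain l where [measurable]: "f \<in> borel_measurable lebesgue" "X \<in> borel_measurable M"
    and l: "\<And>k. \<forall>(c, a, b)\<in>set (l k). a \<le> b"
    and l1: "(\<lambda>k. \<integral>\<^sup>+ s. ennreal ((f s - step_fun (l k) s)\<^sup>2) \<partial>lebesgue) \<longlonglongrightarrow> 0"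
    and l2: "(\<lambda>k. \<integral>\<^sup>+ x. ennreal ((X x - step_integral (l k) (B x))\<^sup>2) \<partial>M) \<longlonglongrightarrow> 0"
    unfolding is_wiener_integral_def by blast
  let ?J = "\<lambda>k. \<integral>\<^sup>+ x. ennreal ((X x - step_integral (m k) (B x))\<^sup>2) \<partial>M"
  let ?u = "\<lambda>k. \<integral>\<^sup>+ x. ennreal ((X x - step_integral (l k) (B x))\<^sup>2) \<partial>M"
  let ?v = "\<lambda>k. \<integral>\<^sup>+ s. ennreal ((f s - step_fun (l k) s)\<^sup>2) \<partial>lebesgue"
  let ?w = "\<lambda>k. \<integral>\<^sup>+ s. ennreal ((f s - step_fun (m k) s)\<^sup>2) \<partial>lebesgue"
  have J: "?J k \<le> 2 * ?u k + 2 * (2 * ?v k + 2 * ?w k)" for k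
  proof -
    have "?J k \<le> (\<integral>\<^sup>+ x. 2 * ennreal ((X x - step_integral (l k) (B x))\<^sup>2) +
        2 * ennreal ((step_integral (l k) (B x) - step_integral (m k) (B x))\<^sup>2) \<partial>M)"
      by (intro nn_integral_mono sq_diff_le)
    also have "\<dots> = 2 * ?u k + 2 * (\<integral>\<^sup>+ x. ennreal ((step_integral (l k @ neg_steps (m k)) (B x))\<^sup>2) \<partial>M)"
      unfolding step_integral_append_neg by (simp add: nn_integral_add nn_integral_cmult)
    also have "(\<integral>\<^sup>+ x. ennreal ((step_integral (l k @ neg_steps (m k)) (B x))\<^sup>2) \<partial>M) =
        (\<integral>\<^sup>+ s. ennreal ((step_fun (l k) s - step_fun (m k) s)\<^sup>2) \<partial>lebesgue)"
    proof (subst wiener_isometry)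
      show "\<forall>(c, a, b)\<in>set (l k @ neg_steps (m k)). a \<le> b"
        using l[of k] m[of k] by (auto simp: neg_steps_def)
    qed (simp only: step_fun_append_neg)
    also have "\<dots> \<le> (\<integral>\<^sup>+ s. 2 * ennreal ((step_fun (l k) s - f s)\<^sup>2) + 2 * ennreal ((f s - step_fun (m k) s)\<^sup>2) \<partial>lebesgue)"
      by (intro nn_integral_mono sq_diff_le)
    also have "\<dots> = 2 * ?v k + 2 * ?w k"
      unfolding power2_commute[of "step_fun (l k) _"] by (simp add: nn_integral_add nn_integral_cmult)
    finally show ?thesis by (simp add: add_left_mono mult_left_mono)
  qed
  have "(\<lambda>k. 2 * ?u k + 2 * (2 * ?v k + 2 * ?w k)) \<longlonglongrightarrow> 2 * 0 + 2 * (2 * 0 + 2 * 0)"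
    by (intro tendsto_add ennreal_tendsto_cmult l1 l2 lim) auto
  then have "?J \<longlonglongrightarrow> 0"
    using J by (intro tendsto_sandwich[OF _ _ tendsto_const[of 0], of ?J]) auto
  then have "liminf ?J = 0" by (intro lim_imp_Liminf) auto
  then have "(\<integral>\<^sup>+ x. liminf (\<lambda>k. ennreal ((X x - step_integral (m k) (B x))\<^sup>2)) \<partial>M) \<le> 0"
    using nn_integral_liminf[of "\<lambda>k x. ennreal ((X x - step_integral (m k) (B x))\<^sup>2)" M] by simp
  then have "AE x in M. liminf (\<lambda>k. ennreal ((X x - step_integral (m k) (B x))\<^sup>2)) = 0"
    by (subst (asm) le_zero_eq, subst (asm) nn_integral_0_iff_AE) auto
  then show ?thesis
  proof (rule AE_mp, intro AE_I2 impI allI)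
    fix x L assume z: "liminf (\<lambda>k. ennreal ((X x - step_integral (m k) (B x))\<^sup>2)) = 0"
      and L: "(\<lambda>k. step_integral (m k) (B x)) \<longlonglongrightarrow> L"
    have lim2: "(\<lambda>k. ennreal ((X x - step_integral (m k) (B x))\<^sup>2)) \<longlonglongrightarrow> ennreal ((X x - L)\<^sup>2)"
      by (intro tendsto_ennrealI tendsto_power tendsto_diff tendsto_const L)
    then have "ennreal ((X x - L)\<^sup>2) = 0" using z lim_imp_Liminf[OF _ lim2] by simp
    then show "X x = L" by (simp add: ennreal_eq_0_iff)
  qed
qed

end



section \<open>Intervals that a path crosses quietly\<close>

text \<open>For \<open>0 \<le> lo \<le> hi\<close> and \<open>0 \<le> t\<close>, the integral of the indicator of \<open>(lo, hi]\<close> against \<open>\<omega>\<close> over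
  \<open>(0, t]\<close>.\<close>

definition increment_across :: "(real \<Rightarrow> real) \<Rightarrow> real \<Rightarrow> real \<Rightarrow> real \<Rightarrow> real" where
  "increment_across \<omega> lo hi t = \<omega> (min hi t) - \<omega> (min lo t)"

text \<open>As a function of \<open>t\<close> the increment across \<open>(lo, hi]\<close> is constant on either side of that interval. So
  it cannot differ between \<open>t\<close> and a point \<open>u\<close> that keeps the distance \<open>r\<close> from the centre \<open>q\<close>, unless
  \<open>t\<close> is far from \<open>u\<close>.\<close>

lemma increment_across_bounds:
  assumes q: "q - lo \<le> r / 2" "hi - q \<le> r / 2" "lo \<le> hi" and r: "r > 0" "r \<le> \<bar>u - q\<bar>"
    and osc: "\<forall>t\<in>{lo..hi}. \<bar>\<omega> t - \<omega> q\<bar> \<le> c" and c: "c \<ge> 0"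
  shows "\<bar>increment_across \<omega> lo hi t\<bar> \<le> 2 * c"
    "\<bar>increment_across \<omega> lo hi t - increment_across \<omega> lo hi u\<bar> \<le> 4 * c"
    "\<bar>t - u\<bar> < r / 2 \<Longrightarrow> increment_across \<omega> lo hi t = increment_across \<omega> lo hi u"
proof -
  have b: "\<bar>increment_across \<omega> lo hi t\<bar> \<le> 2 * c" for t
  proof (cases "t \<le> lo")
    case True
    then have "min hi t = t" "min lo t = t" using q by auto
    then show ?thesis using c by (simp add: increment_across_def)
  next
    case False
    then have "min hi t \<in> {lo..hi}" "min lo t = lo" "lo \<in> {lo..hi}" using q by auto
    then show ?thesis
      using osc[rule_format, of "min hi t"] osc[rule_format, of lo] unfolding increment_across_def by simp
  qed
  show "\<bar>increment_across \<omega> lo hi t\<bar> \<le> 2 * c" by (rule b)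
  show "\<bar>increment_across \<omega> lo hi t - increment_across \<omega> lo hi u\<bar> \<le> 4 * c"
    using b[of t] b[of u] by linarith
  show "increment_across \<omega> lo hi t = increment_across \<omega> lo hi u" if "\<bar>t - u\<bar> < r / 2"
  proof (cases "u \<le> q")
    case True
    then have "u \<le> lo" "t \<le> lo" using q r that by linarith+
    then have "min hi t = t" "min lo t = t" "min hi u = u" "min lo u = u" using q by auto
    then show ?thesis by (simp add: increment_across_def)
  next
    case False
    then have "hi \<le> u" "hi \<le> t" using q r that by linarith+
    then have "min hi t = hi" "min lo t = lo" "min hi u = hi" "min lo u = lo" using q by auto
    then show ?thesis by (simp add: increment_across_def)
  qed
qed

context prob_space
begin

lemma small_oscillation:
  assumes X: "continuous_process M X" and \<rho>: "\<rho>0 > 0" and c: "c > 0" and e: "e > 0"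
  shows "\<exists>\<rho> A. 0 < \<rho> \<and> \<rho> \<le> \<rho>0 \<and> A \<in> events \<and> prob A < e \<and>
    (\<forall>x\<in>space M - A. \<forall>t\<in>{q - \<rho>..q + \<rho>}. \<bar>X x t - X x q\<bar> \<le> c)"
proof -
  define \<rho> where "\<rho> n = \<rho>0 / real (Suc n)" for n
  have \<rho>_pos: "0 < \<rho> n" and \<rho>_le: "\<rho> n \<le> \<rho>0" for n
    using \<rho> unfolding \<rho>_def by (auto simp: field_simps)
  have cp: "continuous_process M (\<lambda>x t. \<bar>X x t - X x q\<bar>)"
    using X unfolding continuous_process_def
    by (auto intro!: continuous_intros borel_measurable_abs borel_measurable_diff)
  have cont: "continuous_on UNIV (\<lambda>t. \<bar>X x t - X x q\<bar>)" if "x \<in> space M" for x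
    using cp that unfolding continuous_process_def by auto
  have le: "q - \<rho> n \<le> q + \<rho> n" for n using \<rho>_pos[of n] by linarith
  define A where "A n = {x \<in> space M. maxval (\<lambda>t. \<bar>X x t - X x q\<bar>) (q - \<rho> n) (q + \<rho> n) > c}" for n
  have A: "A n \<in> events" for n
    unfolding A_def using maxval_measurable[OF cp le] by measurable
  have "\<exists>n. prob (A n) < e"
  proof (rule prob_small[OF A _ e], rule AE_I2)
    fix x assume x: "x \<in> space M"
    have "isCont (X x) q" using X x unfolding continuous_process_def by (auto simp: continuous_on_eq_continuous_at)
    then obtain d where d: "d > 0" "\<And>t. \<bar>t - q\<bar> < d \<Longrightarrow> \<bar>X x t - X x q\<bar> < c"
      using c unfolding continuous_at_eps_delta by (auto simp: dist_real_def)
    have "\<rho> \<longlonglongrightarrow> 0"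
      unfolding \<rho>_def using LIMSEQ_inverse_real_of_nat tendsto_mult_right_zero[of _ sequentially \<rho>0]
      by (simp add: divide_inverse)
    then have "\<forall>\<^sub>F n in sequentially. \<rho> n < d" using d(1) by (rule order_tendstoD)
    then show "\<forall>\<^sub>F n in sequentially. x \<notin> A n"
    proof (rule eventually_mono)
      fix n assume n: "\<rho> n < d"
      have "\<bar>X x t - X x q\<bar> \<le> c" if "t \<in> {q - \<rho> n..q + \<rho> n}" for t
      proof -
        have "\<bar>t - q\<bar> < d" using n that by auto
        then show ?thesis using d(2) by (simp add: less_imp_le)
      qed
      then have "maxval (\<lambda>t. \<bar>X x t - X x q\<bar>) (q - \<rho> n) (q + \<rho> n) \<le> c"
        unfolding maxval_le_iff[OF cont[OF x] le] by blast
      then show "x \<notin> A n" by (simp add: A_def)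
    qed
  qed
  then obtain n where n: "prob (A n) < e" by blast
  have "\<bar>X x t - X x q\<bar> \<le> c" if "x \<in> space M - A n" "t \<in> {q - \<rho> n..q + \<rho> n}" for x t
  proof -
    have "maxval (\<lambda>t. \<bar>X x t - X x q\<bar>) (q - \<rho> n) (q + \<rho> n) \<le> c"
      using that(1) by (simp add: A_def not_less)
    then show ?thesis using that maxval_le_iff[OF cont le] by blast
  qed
  then show ?thesis using \<rho>_pos \<rho>_le A n by blast
qed

text \<open>This is the heart of the argument. Let \<open>\<tau>\<close> be the maximum time of \<open>W\<close>. The law of \<open>\<tau>\<close> has at most
  countably many atoms, so some \<open>q\<close> between \<open>\<alpha>\<close> and \<open>\<beta>\<close> is not an atom, and \<open>\<tau>\<close> keeps some distance \<open>r\<close> from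
  \<open>q\<close> except on a small event. As the maximum is unique, \<open>W\<close> stays below its maximum by some
  \<open>\<delta> > 0\<close> at distance more than \<open>r / 4\<close> from \<open>\<tau>\<close>, again up to a small event. Only now the interval around
  \<open>q\<close> is chosen, so short that both paths oscillate there by much less than \<open>\<kappa> \<delta>\<close>. Whether \<open>t\<close> is near
  \<open>\<tau>\<close> or not, the increment across this interval then changes between \<open>\<tau>\<close> and \<open>t\<close> by at most \<open>\<kappa>\<close> times
  the gap \<open>W \<tau> - W t\<close>.\<close>

lemma quiet_interval:
  assumes W: "continuous_process M W" and V: "continuous_process M V"
    and uniq: "AE x in M. first_max (W x) 0 1 = last_max (W x) 0 1"
    and ab: "\<alpha> < \<beta>" and \<kappa>: "\<kappa> > 0" and e: "e > 0"
  shows "\<exists>lo hi A. \<alpha> < lo \<and> lo < hi \<and> hi < \<beta> \<and> A \<in> events \<and> prob A < e \<and>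
    (\<forall>x\<in>space M - A. \<forall>\<omega>\<in>{W x, V x}. \<forall>t\<in>{0..1}. \<bar>increment_across \<omega> lo hi t\<bar> \<le> \<kappa> \<and>
       \<bar>increment_across \<omega> lo hi t - increment_across \<omega> lo hi (first_max (W x) 0 1)\<bar>
         \<le> \<kappa> * (W x (first_max (W x) 0 1) - W x t))"
proof -
  define \<tau> where "\<tau> x = first_max (W x) 0 1" for x
  have c: "continuous_on UNIV (W x)" if "x \<in> space M" for x
    using W that unfolding continuous_process_def by auto
  have [measurable]: "\<tau> \<in> borel_measurable M"
    unfolding \<tau>_def[abs_def] using first_max_measurable[OF W] by simp
  have [measurable]: "(\<lambda>x. maxval (W x) 0 1) \<in> borel_measurable M"
    using maxval_measurable[OF W] by simp
  have [measurable]: "(\<lambda>x. W x t) \<in> borel_measurable M" for t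
    using W unfolding continuous_process_def by auto
  have \<tau>: "\<tau> x \<in> {0..1}" "W x (\<tau> x) = maxval (W x) 0 1" if "x \<in> space M" for x
    using first_max_props[OF c[OF that], of 0 1] unfolding \<tau>_def by auto
  have top: "W x t \<le> W x (\<tau> x)" if "x \<in> space M" "t \<in> {0..1}" for x t
    using maxval_upper[OF c[OF that(1)] that(2)] \<tau>[OF that(1)] by simp
  interpret T: prob_space "distr M borel \<tau>" by (rule prob_space_distr) simp
  have "uncountable ({\<alpha><..<\<beta>} - {q. measure (distr M borel \<tau>) {q} \<noteq> 0})" (is "uncountable ?U")
    using T.countable_support ab by (intro uncountable_minus_countable) (auto simp: uncountable_open_interval)
  then have "?U \<noteq> {}" using countable_empty by metis
  then obtain q where q: "\<alpha> < q" "q < \<beta>" "measure (distr M borel \<tau>) {q} = 0" by auto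
  have "prob {x \<in> space M. \<tau> x = q} = 0"
    using q(3) by (simp add: measure_distr vimage_def Int_def conj_commute)
  then have "AE x in M. \<tau> x \<noteq> q"
    by (subst prob_Collect_eq_0[symmetric]) auto
  define A1 where "A1 n = {x \<in> space M. \<bar>\<tau> x - q\<bar> < 1 / real (Suc n)}" for n
  have A1: "A1 n \<in> events" for n unfolding A1_def by measurable
  have "\<exists>n. prob (A1 n) < e / 4"
  proof (rule prob_small[OF A1])
    show "AE x in M. \<forall>\<^sub>F n in sequentially. x \<notin> A1 n"
      using \<open>AE x in M. \<tau> x \<noteq> q\<close>
    proof eventually_elim
      fix x assume "\<tau> x \<noteq> q"
      then have "\<forall>\<^sub>F n in sequentially. inverse (real (Suc n)) < \<bar>\<tau> x - q\<bar>"
        by (intro order_tendstoD(2)[OF LIMSEQ_inverse_real_of_nat]) auto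
      then show "\<forall>\<^sub>F n in sequentially. x \<notin> A1 n"
        by eventually_elim (simp add: A1_def inverse_eq_divide)
    qed
  qed (use e in simp)
  then obtain n1 where n1: "prob (A1 n1) < e / 4" by blast
  define r where "r = 1 / real (Suc n1)"
  have r: "r > 0" by (simp add: r_def)
  \<comment> \<open>The maximum of this process over \<open>[0, 1]\<close> is nonpositive iff \<open>W\<close> has the gap \<open>1 / Suc n\<close> outside the \<open>r / 4\<close>-neighbourhood of \<open>\<tau>\<close>.\<close>
  define G where "G n x t = min (W x t - maxval (W x) 0 1 + 1 / real (Suc n)) (\<bar>t - \<tau> x\<bar> - r / 4)" for n x t
  have G: "continuous_process M (G n)" for n
    unfolding continuous_process_def G_def using c by (auto intro!: continuous_intros)
  have Gc: "continuous_on UNIV (G n x)" if "x \<in> space M" for n x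
    using G that unfolding continuous_process_def by auto
  define A2 where "A2 n = {x \<in> space M. maxval (G n x) 0 1 > 0}" for n
  have A2: "A2 n \<in> events" for n
    unfolding A2_def using maxval_measurable[OF G, of 0 1] by measurable
  have "\<exists>n. prob (A2 n) < e / 4"
  proof (rule prob_small[OF A2])
    show "AE x in M. \<forall>\<^sub>F n in sequentially. x \<notin> A2 n"
      using uniq
    proof (rule AE_mp, intro AE_I2 impI)
      fix x assume x: "x \<in> space M" "first_max (W x) 0 1 = last_max (W x) 0 1"
      have strict: "W x t < W x (\<tau> x)" if "t \<in> {0..1}" "t \<noteq> \<tau> x" for t
        using first_eq_last_iff[OF c[OF x(1)], of 0 1 "\<tau> x"] \<tau>[OF x(1)] x(2) that unfolding \<tau>_def by auto
      let ?S = "{0..1} - ball (\<tau> x) (r / 4)"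
      have "\<exists>d>0. \<forall>t\<in>?S. W x t \<le> W x (\<tau> x) - d"
      proof (cases "?S = {}")
        case True
        show ?thesis unfolding True by (intro exI[of _ 1]) simp
      next
        case False
        have "compact ?S" by (intro compact_diff) auto
        moreover have "continuous_on ?S (W x)" using c[OF x(1)] continuous_on_subset by blast
        ultimately obtain s where s: "s \<in> ?S" "\<forall>t\<in>?S. W x t \<le> W x s"
          using continuous_attains_sup False by blast
        then have "W x s < W x (\<tau> x)" using r by (intro strict) auto
        then show ?thesis using s by (intro exI[of _ "W x (\<tau> x) - W x s"]) auto
      qed
      then obtain d where d: "d > 0" "\<And>t. t \<in> {0..1} \<Longrightarrow> r / 4 \<le> \<bar>t - \<tau> x\<bar> \<Longrightarrow> W x t \<le> W x (\<tau> x) - d"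
        by (force simp: dist_real_def abs_minus_commute not_less)
      have "\<forall>\<^sub>F n in sequentially. inverse (real (Suc n)) < d"
        using d(1) by (intro order_tendstoD(2)[OF LIMSEQ_inverse_real_of_nat])
      then show "\<forall>\<^sub>F n in sequentially. x \<notin> A2 n"
      proof (rule eventually_mono)
        fix n assume n: "inverse (real (Suc n)) < d"
        have "G n x t \<le> 0" if "t \<in> {0..1}" for t
        proof (cases "r / 4 \<le> \<bar>t - \<tau> x\<bar>")
          case True
          then have "W x t - maxval (W x) 0 1 + 1 / real (Suc n) \<le> 0"
            using d(2)[OF that True] n \<tau>(2)[OF x(1)] unfolding inverse_eq_divide by linarith
          then show ?thesis unfolding G_def by (rule min.coboundedI1)
        next
          case False
          then show ?thesis unfolding G_def by (intro min.coboundedI2) linarith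
        qed
        then have "maxval (G n x) 0 1 \<le> 0" using maxval_le_iff[OF Gc[OF x(1)], of 0 1] by simp
        then show "x \<notin> A2 n" by (simp add: A2_def)
      qed
    qed
  qed (use e in simp)
  then obtain n2 where n2: "prob (A2 n2) < e / 4" by blast
  define \<delta> where "\<delta> = 1 / real (Suc n2)"
  have \<delta>: "\<delta> > 0" "\<delta> \<le> 1" by (auto simp: \<delta>_def)
  have gap: "W x t \<le> W x (\<tau> x) - \<delta>" if "x \<in> space M - A2 n2" "t \<in> {0..1}" "\<bar>t - \<tau> x\<bar> > r / 4" for x t
  proof -
    have "maxval (G n2 x) 0 1 \<le> 0" using that(1) by (simp add: A2_def not_less)
    then have "G n2 x t \<le> 0" using maxval_le_iff[OF Gc[of x n2], of 0 1] that by auto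
    then show ?thesis using that(3) \<tau>(2)[of x] that(1) unfolding G_def \<delta>_def by (auto simp: min_def split: if_splits)
  qed
  define \<rho>0 where "\<rho>0 = min (r / 2) (min ((q - \<alpha>) / 2) ((\<beta> - q) / 2))"
  have \<rho>0: "\<rho>0 > 0" "\<rho>0 \<le> r / 2" "\<alpha> < q - \<rho>0" "q + \<rho>0 < \<beta>"
    using r q unfolding \<rho>0_def by (auto simp: min_def field_simps)
  define C where "C = \<kappa> * \<delta> / 4"
  have C: "C > 0" "4 * C = \<kappa> * \<delta>" using \<kappa> \<delta> by (auto simp: C_def)
  have "4 * C \<le> \<kappa>" using C(2) \<kappa> \<delta> by (simp add: mult_left_le)
  obtain \<rho>1 A3 where 3: "0 < \<rho>1" "\<rho>1 \<le> \<rho>0" "A3 \<in> events" "prob A3 < e / 4"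
    "\<And>x t. x \<in> space M - A3 \<Longrightarrow> t \<in> {q - \<rho>1..q + \<rho>1} \<Longrightarrow> \<bar>W x t - W x q\<bar> \<le> C"
    using small_oscillation[OF W \<rho>0(1) C(1), of "e / 4" q] e by auto
  obtain \<rho>2 A4 where 4: "0 < \<rho>2" "\<rho>2 \<le> \<rho>0" "A4 \<in> events" "prob A4 < e / 4"
    "\<And>x t. x \<in> space M - A4 \<Longrightarrow> t \<in> {q - \<rho>2..q + \<rho>2} \<Longrightarrow> \<bar>V x t - V x q\<bar> \<le> C"
    using small_oscillation[OF V \<rho>0(1) C(1), of "e / 4" q] e by auto
  define \<rho> where "\<rho> = min \<rho>1 \<rho>2"
  have \<rho>: "0 < \<rho>" "\<rho> \<le> \<rho>0" "\<rho> \<le> \<rho>1" "\<rho> \<le> \<rho>2" using 3 4 by (auto simp: \<rho>_def)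
  define A where "A = (A1 n1 \<union> A2 n2) \<union> (A3 \<union> A4)"
  have A: "A \<in> events" unfolding A_def using A1 A2 3 4 by auto
  have "prob A \<le> prob (A1 n1 \<union> A2 n2) + prob (A3 \<union> A4)"
    unfolding A_def using A1 A2 3 4 by (intro measure_Un_le) auto
  also have "\<dots> \<le> (prob (A1 n1) + prob (A2 n2)) + (prob A3 + prob A4)"
    using A1 A2 3 4 by (intro add_mono measure_Un_le) auto
  also have "\<dots> < e" using n1 n2 3 4 by linarith
  finally have pA: "prob A < e" .
  have main: "\<bar>increment_across \<omega> (q - \<rho>) (q + \<rho>) t\<bar> \<le> \<kappa> \<and>
       \<bar>increment_across \<omega> (q - \<rho>) (q + \<rho>) t - increment_across \<omega> (q - \<rho>) (q + \<rho>) (\<tau> x)\<bar>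
         \<le> \<kappa> * (W x (\<tau> x) - W x t)"
    if x: "x \<in> space M - A" and \<omega>: "\<omega> \<in> {W x, V x}" and t: "t \<in> {0..1}" for x \<omega> t
  proof -
    have osc: "\<forall>s\<in>{q - \<rho>..q + \<rho>}. \<bar>\<omega> s - \<omega> q\<bar> \<le> C"
      using 3(5)[of x] 4(5)[of x] \<omega> x \<rho> unfolding A_def by auto
    have far: "r \<le> \<bar>\<tau> x - q\<bar>" using x unfolding A_def A1_def r_def by (auto simp: not_less)
    have "q - (q - \<rho>) \<le> r / 2" "q + \<rho> - q \<le> r / 2" "q - \<rho> \<le> q + \<rho>" "C \<ge> 0"
      using \<rho> \<rho>0 C by auto
    note b = increment_across_bounds[OF this(1-3) r far osc this(4)]
    have nonneg: "0 \<le> \<kappa> * (W x (\<tau> x) - W x t)" using top[of x t] x t \<kappa> by simp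
    have "\<bar>increment_across \<omega> (q - \<rho>) (q + \<rho>) t - increment_across \<omega> (q - \<rho>) (q + \<rho>) (\<tau> x)\<bar>
         \<le> \<kappa> * (W x (\<tau> x) - W x t)"
    proof (cases "\<bar>t - \<tau> x\<bar> < r / 2")
      case True
      then show ?thesis using b(3)[OF True] nonneg by simp
    next
      case False
      then have "W x t \<le> W x (\<tau> x) - \<delta>" using gap[of x t] x t r unfolding A_def by auto
      then have "\<kappa> * \<delta> \<le> \<kappa> * (W x (\<tau> x) - W x t)" using \<kappa> by (intro mult_left_mono) auto
      then show ?thesis using b(2)[of t] C(2) by linarith
    qed
    then show ?thesis using b(1)[of t] \<open>4 * C \<le> \<kappa>\<close> C(1) by linarith
  qed
  show ?thesis
    using \<rho> \<rho>0 A pA main unfolding \<tau>_def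
    by (intro exI[of _ "q - \<rho>"] exI[of _ "q + \<rho>"] exI[of _ A]) auto
qed

end

section \<open>Removing disjoint intervals\<close>

lemma maximal_disjoint_subfamily:
  assumes ne: "\<And>n. I n \<noteq> {}"
  shows "\<exists>K. disjoint_family_on I K \<and> (\<forall>n. \<exists>k\<in>K. I n \<inter> I k \<noteq> {})"
proof -
  let ?R = "\<lambda>i j. I i \<inter> I j = {}"
  have "\<exists>K\<in>{K. pairwise ?R K}. \<forall>L\<in>{K. pairwise ?R K}. K \<subseteq> L \<longrightarrow> L = K"
  proof (rule subset_Zorn_nonempty)
    show "{K. pairwise ?R K} \<noteq> {}" by (intro ex_in_conv[THEN iffD1] exI[of _ "{}"]) simp
    show "\<Union>\<C> \<in> {K. pairwise ?R K}" if "subset.chain {K. pairwise ?R K} \<C>" for \<C>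
      using that by (auto intro!: pairwise_chain_Union simp: subset_chain_def chain_subset_def)
  qed
  then obtain K where K: "pairwise ?R K" "\<And>L. pairwise ?R L \<Longrightarrow> K \<subseteq> L \<Longrightarrow> L = K" by auto
  have "\<exists>k\<in>K. I n \<inter> I k \<noteq> {}" for n
  proof (rule ccontr)
    assume no: "\<not> ?thesis"
    then have "pairwise ?R (insert n K)" using K(1) by (auto simp: pairwise_insert Int_commute)
    then have "insert n K = K" using K(2) by blast
    then show False using no ne[of n] by auto
  qed
  then show ?thesis using K(1) unfolding pairwise_def disjoint_family_on_def by blast
qed

text \<open>A rational interval inside the set would contain some interval \<open>k\<close>; even if \<open>k\<close> is not removed itself,
  it meets a removed one.\<close>

lemma interior_minus_intervals:
  fixes lo hi :: "nat \<Rightarrow> real"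
  assumes dense: "\<And>u v. u \<in> \<rat> \<Longrightarrow> v \<in> \<rat> \<Longrightarrow> 0 < u \<Longrightarrow> u < v \<Longrightarrow> v < 1 \<Longrightarrow> \<exists>k. u < lo k \<and> hi k < v"
    and maximal: "\<And>k. \<exists>j\<in>K. {lo k<..hi k} \<inter> {lo j<..hi j} \<noteq> {}"
  shows "interior ({0..1} - (\<Union>k\<in>K. {lo k<..<hi k})) = {}" (is "interior ?F = {}")
proof (rule ccontr)
  assume "interior ?F \<noteq> {}"
  then obtain x r where r: "r > 0" "ball x r \<subseteq> interior ?F"
    using open_interior open_contains_ball by blast
  have sub: "y \<in> ?F" if "x - r < y" "y < x + r" for y
  proof -
    have "y \<in> ball x r" using that by (auto simp: dist_real_def)
    then show ?thesis using r(2) interior_subset by blast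
  qed
  obtain u where u: "u \<in> \<rat>" "x < u" "u < x + r" using Rats_dense_in_real[of x "x + r"] r(1) by auto
  obtain v where v: "v \<in> \<rat>" "u < v" "v < x + r" using Rats_dense_in_real[of u "x + r"] u by auto
  have "0 \<le> x" "v \<le> 1" using sub[of x] sub[of v] r(1) u v by auto
  moreover have "(v + (x + r)) / 2 \<le> 1" using sub[of "(v + (x + r)) / 2"] r(1) u v by auto
  ultimately have "0 < u" "v < 1" using u v by auto
  then obtain k where k: "u < lo k" "hi k < v" using dense[OF u(1) v(1)] v(2) by blast
  obtain j z where j: "j \<in> K" "z \<in> {lo k<..hi k}" "z \<in> {lo j<..hi j}" using maximal[of k] by blast
  define y where "y = (max (lo j) (x - r) + z) / 2"
  have z: "x - r < z" "z < x + r" using j(2) k u v r(1) by auto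
  have "lo j < y" "y < hi j" "x - r < y" "y < x + r"
    using z j(3) unfolding y_def by (auto simp: max_def)
  then show False using sub[of y] j(1) by auto
qed

section \<open>The perturbed path\<close>

text \<open>The mixture \<open>y\<close> is \<open>\<omega>\<close> on \<open>[0, a]\<close>, perturbed across the intervals \<open>(lo k, hi k]\<close>, and continues with the
  increments of \<open>v\<close> after \<open>a\<close>. The perturbations sum up to at most half the gap \<open>\<omega> \<tau> - \<omega> t\<close>, so \<open>\<tau>\<close> remains
  the unique maximum time on \<open>[0, a]\<close>. At \<open>a\<close> at least half of the gap \<open>2 h + 1\<close> is left, which is more than
  \<open>v\<close> can make up for after \<open>a\<close>.\<close>

lemma same_maximum:
  fixes lo hi c :: "nat \<Rightarrow> real"
  assumes a: "0 < a" "a < 1" and \<omega>: "continuous_on UNIV \<omega>" "\<omega> 0 = 0" and v: "continuous_on UNIV v"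
    and uniq: "first_max \<omega> 0 1 = last_max \<omega> 0 1"
    and start: "0 < \<omega> (a / 2)" "maxval \<omega> a 1 \<le> \<omega> (a / 2) - (2 * h + 1)" "maxval v a 1 \<le> v a + h" and h: "h \<ge> 0"
    and c: "\<And>k. \<bar>c k\<bar> \<le> 1"
    and small: "\<And>k t \<eta>. t \<in> {0..a} \<Longrightarrow> \<eta> \<in> {\<omega>, v} \<Longrightarrow> \<bar>increment_across \<eta> (lo k) (hi k) t\<bar> \<le> (1 / 2) ^ (k + 3)"
    and close: "\<And>k t \<eta>. t \<in> {0..a} \<Longrightarrow> \<eta> \<in> {\<omega>, v} \<Longrightarrow>
       \<bar>increment_across \<eta> (lo k) (hi k) t - increment_across \<eta> (lo k) (hi k) (first_max \<omega> 0 1)\<bar>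
         \<le> (1 / 2) ^ (k + 3) * (\<omega> (first_max \<omega> 0 1) - \<omega> t)"
    and y: "\<And>t. t \<in> {0..1} \<Longrightarrow> y t = \<omega> (min t a) + v t - v (min t a) +
       (\<Sum>k. c k * (increment_across v (lo k) (hi k) (min t a) - increment_across \<omega> (lo k) (hi k) (min t a)))"
  shows "maximizer \<omega> = maximizer y"
proof -
  define \<tau> where "\<tau> = first_max \<omega> 0 1"
  have \<tau>: "\<tau> \<in> {0..1}" "\<omega> \<tau> = maxval \<omega> 0 1"
    using first_max_props(1,2)[OF \<omega>(1), of 0 1] unfolding \<tau>_def by auto
  have top: "\<omega> t \<le> \<omega> \<tau>" if "t \<in> {0..1}" for t using maxval_upper[OF \<omega>(1) that] \<tau> by simp
  have strict: "\<omega> t < \<omega> \<tau>" if "t \<in> {0..1}" "t \<noteq> \<tau>" for t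
    using first_eq_last_iff[OF \<omega>(1), of 0 1 \<tau>] \<tau>(1) uniq that unfolding \<tau>_def by auto
  have mid: "\<omega> (a / 2) \<le> \<omega> \<tau>" using a by (intro top) auto
  have late: "\<omega> t \<le> \<omega> (a / 2) - (2 * h + 1)" if "t \<in> {a..1}" for t
    using maxval_upper[OF \<omega>(1) that] start(2) by linarith
  have "\<tau> \<noteq> 0" using mid start(1) \<omega>(2) by auto
  moreover have "\<tau> < a" using late[of \<tau>] mid h \<tau>(1) by fastforce
  ultimately have \<tau>a: "0 < \<tau>" "\<tau> < a" using \<tau>(1) by auto
  define d where "d k t = c k * (increment_across v (lo k) (hi k) t - increment_across \<omega> (lo k) (hi k) t)" for k t
  have geo: "summable (\<lambda>k. (1 / 2 :: real) ^ (k + 3))" "summable (\<lambda>k. (1 / 2 :: real) ^ (k + 2))"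
    unfolding power_add by (intro summable_mult2 summable_geometric; simp)+
  have half: "(1 / 2 :: real) ^ (k + 3) + (1 / 2) ^ (k + 3) = (1 / 2) ^ (k + 2)" for k
    by (simp add: power_add power2_eq_square power3_eq_cube)
  have sum_geo: "(\<Sum>k. (1 / 2 :: real) ^ (k + 2)) = 1 / 2"
  proof -
    have "(\<Sum>k. (1 / 2 :: real) ^ k * (1 / 2) ^ 2) = (\<Sum>k. (1 / 2) ^ k) * (1 / 2) ^ 2"
      by (intro suminf_mult2[symmetric] summable_geometric) simp
    then show ?thesis unfolding power_add by (simp add: suminf_geometric power2_eq_square)
  qed
  have dbound: "\<bar>d k t\<bar> \<le> (1 / 2) ^ (k + 2)" if "t \<in> {0..a}" for k t
  proof -
    have "\<bar>d k t\<bar> \<le> 1 * \<bar>increment_across v (lo k) (hi k) t - increment_across \<omega> (lo k) (hi k) t\<bar>"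
      unfolding d_def abs_mult using c[of k] by (intro mult_right_mono) auto
    also have "\<dots> \<le> (1 / 2) ^ (k + 3) + (1 / 2) ^ (k + 3)"
      using small[OF that, of v k] small[OF that, of \<omega> k] by auto
    finally show ?thesis unfolding half .
  qed
  have dsum: "summable (\<lambda>k. d k t)" if "t \<in> {0..a}" for t
    using dbound[OF that] by (intro summable_comparison_test'[OF geo(2), of 0]) auto
  have diff: "\<bar>(\<Sum>k. d k t) - (\<Sum>k. d k \<tau>)\<bar> \<le> (\<omega> \<tau> - \<omega> t) / 2" if t: "t \<in> {0..a}" for t
  proof -
    have b: "\<bar>d k t - d k \<tau>\<bar> \<le> (1 / 2) ^ (k + 2) * (\<omega> \<tau> - \<omega> t)" for k
    proof -
      let ?x = "increment_across v (lo k) (hi k) t - increment_across v (lo k) (hi k) \<tau>"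
      let ?y = "increment_across \<omega> (lo k) (hi k) t - increment_across \<omega> (lo k) (hi k) \<tau>"
      have "d k t - d k \<tau> = c k * (?x - ?y)" by (simp add: d_def algebra_simps)
      then have "\<bar>d k t - d k \<tau>\<bar> \<le> 1 * \<bar>?x - ?y\<bar>"
        using c[of k] by (simp only: abs_mult) (intro mult_right_mono, auto)
      also have "\<dots> \<le> (1 / 2) ^ (k + 3) * (\<omega> \<tau> - \<omega> t) + (1 / 2) ^ (k + 3) * (\<omega> \<tau> - \<omega> t)"
      proof -
        have xy: "\<bar>?x\<bar> \<le> (1 / 2) ^ (k + 3) * (\<omega> \<tau> - \<omega> t)" "\<bar>?y\<bar> \<le> (1 / 2) ^ (k + 3) * (\<omega> \<tau> - \<omega> t)"
          unfolding \<tau>_def using close[OF t, of v k] close[OF t, of \<omega> k] by blast+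
        show ?thesis
          unfolding mult_1 by (rule order_trans[OF abs_triangle_ineq4 add_mono[OF xy]])
      qed
      finally show ?thesis unfolding distrib_right[symmetric] half .
    qed
    have "\<tau> \<in> {0..a}" using \<tau>a by auto
    have "norm (\<Sum>k. d k t - d k \<tau>) \<le> (\<Sum>k. (1 / 2) ^ (k + 2) * (\<omega> \<tau> - \<omega> t))"
      using b geo(2) by (intro norm_suminf_le summable_mult2) auto
    also have "\<dots> = (\<omega> \<tau> - \<omega> t) / 2"
      by (subst suminf_mult2[symmetric, OF geo(2)]) (simp only: sum_geo)
    also have "(\<Sum>k. d k t - d k \<tau>) = (\<Sum>k. d k t) - (\<Sum>k. d k \<tau>)"
      using dsum[OF t] dsum[OF \<open>\<tau> \<in> {0..a}\<close>] by (intro suminf_diff[symmetric])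
    finally show ?thesis by simp
  qed
  have yt: "y t = \<omega> t + (\<Sum>k. d k t)" if "t \<in> {0..a}" for t
    using y[of t] that a by (simp add: d_def min_def)
  have early: "y t - y \<tau> \<le> - (\<omega> \<tau> - \<omega> t) / 2" if "t \<in> {0..a}" for t
  proof -
    have "\<tau> \<in> {0..a}" using \<tau>a by auto
    then show ?thesis using abs_le_D1[OF diff[OF that]] yt[OF that] yt[of \<tau>] by argo
  qed
  have "y t < y \<tau>" if t: "t \<in> {0..1}" "t \<noteq> \<tau>" for t
  proof (cases "t \<le> a")
    case True
    then show ?thesis using early[of t] strict[OF t] t by auto
  next
    case False
    then have "y t = y a + (v t - v a)" using y[OF t(1)] yt[of a] a by (simp add: d_def min_def)
    moreover have "v t - v a \<le> h" using maxval_upper[OF v, of t a 1] start(3) t False by auto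
    moreover have "y a - y \<tau> \<le> - (2 * h + 1) / 2" using early[of a] late[of a] mid a by auto
    ultimately show ?thesis by argo
  qed
  then have "maximizer y = Some \<tau>" using \<tau>a a by (intro maximizer_Some) auto
  moreover have "maximizer \<omega> = Some \<tau>" using \<tau>a a strict by (intro maximizer_Some) auto
  ultimately show ?thesis by simp
qed



section \<open>The paths of the mixture\<close>

text \<open>A step function that approximates the indicator of \<open>(0, b]\<close> minus the union of the holes; \<open>K\<close> enters through
  the coefficients.\<close>

definition hole_steps :: "(nat \<Rightarrow> real) \<Rightarrow> (nat \<Rightarrow> real) \<Rightarrow> nat set \<Rightarrow> real \<Rightarrow> nat \<Rightarrow> (real \<times> real \<times> real) list" where
  "hole_steps lo hi K b n = (1, 0, b) #
     map (\<lambda>k. (- indicator K k, min (lo k) b, min (hi k) b)) [0..<n]"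

lemma step_integral_hole_steps:
  "step_integral (hole_steps lo hi K b n) \<beta> =
     \<beta> b - \<beta> 0 - (\<Sum>k<n. indicator K k * increment_across \<beta> (lo k) (hi k) b)"
  unfolding step_integral_def hole_steps_def increment_across_def
  by (simp add: o_def interv_sum_list_conv_sum_set_nat atLeast0LessThan sum_negf)

lemma step_fun_hole_steps:
  assumes "\<And>k. 0 \<le> lo k"
  shows "step_fun (hole_steps lo hi K b n) s =
     indicator {0<..b} s * (1 - (\<Sum>k<n. indicator K k * indicator {lo k<..hi k} s))"
proof -
  have *: "indicator {min (lo k) b<..min (hi k) b} s = (indicator {0<..b} s * indicator {lo k<..hi k} s :: real)" for k
    using assms[of k] by (auto simp: indicator_def min_def split: if_splits)
  show ?thesis
    unfolding step_fun_def hole_steps_def list.map sum_list.Cons map_map o_def prod.case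
      interv_sum_list_conv_sum_set_nat set_upt atLeast0LessThan * right_diff_distrib sum_distrib_left
    by (simp only: mult_minus_left sum_negf mult_1_left mult_1_right mult.left_commute
        add_uminus_conv_diff)
qed

lemma hole_steps_ordered:
  assumes "\<And>k. lo k \<le> hi k" "0 \<le> b"
  shows "\<forall>(c, x, y)\<in>set (hole_steps lo hi K b n). x \<le> y"
  using assms unfolding hole_steps_def by (auto simp: min_le_iff_disj intro: min.mono)

text \<open>Disjointness makes the sum of the indicators an indicator, so dominated convergence applies. The
  right endpoints, where half-open and open intervals differ, form a countable set.\<close>

lemma hole_steps_tendsto:
  assumes lo: "\<And>k. 0 \<le> lo k" and b: "0 \<le> b" "b \<le> 1"
    and disj: "disjoint_family_on (\<lambda>k. {lo k<..hi k}) K"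
  shows "(\<lambda>n. \<integral>\<^sup>+ s. ennreal ((indicator ({0<..b} - (\<Union>k\<in>K. {lo k<..<hi k})) s -
      step_fun (hole_steps lo hi K b n) s)\<^sup>2) \<partial>lebesgue) \<longlonglongrightarrow> 0"
proof -
  let ?f = "indicator ({0<..b} - (\<Union>k\<in>K. {lo k<..<hi k})) :: real \<Rightarrow> real"
  let ?u = "\<lambda>n s. ennreal ((?f s - step_fun (hole_steps lo hi K b n) s)\<^sup>2)"
  have S: "{0<..b} - (\<Union>k\<in>K. {lo k<..<hi k}) \<in> sets lebesgue" by auto
  have cnt: "(\<Sum>k<n. indicator K k * indicator {lo k<..hi k} s) =
      (if \<exists>k\<in>K. k < n \<and> s \<in> {lo k<..hi k} then 1 else 0 :: real)" for n s
  proof (cases "\<exists>k\<in>K. k < n \<and> s \<in> {lo k<..hi k}")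
    case True
    then obtain k where k: "k \<in> K" "k < n" "s \<in> {lo k<..hi k}" by blast
    have "(\<Sum>j<n. indicator K j * indicator {lo j<..hi j} s) = (\<Sum>j<n. if j = k then 1 else 0 :: real)"
    proof (intro sum.cong refl)
      fix j
      show "indicator K j * indicator {lo j<..hi j} s = (if j = k then 1 else 0 :: real)"
      proof (cases "j = k")
        case True then show ?thesis using k by simp
      next
        case False
        then have "j \<notin> K \<or> s \<notin> {lo j<..hi j}" using disj k unfolding disjoint_family_on_def by blast
        then show ?thesis using False by (auto simp: indicator_def)
      qed
    qed
    then show ?thesis using True k by simp
  next
    case False
    then have "(\<Sum>j<n. indicator K j * indicator {lo j<..hi j} s) = (\<Sum>j<n. 0 :: real)"
      by (intro sum.cong refl) (auto simp: indicator_def)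
    then show ?thesis unfolding if_not_P[OF False] by simp
  qed
  have step: "step_fun (hole_steps lo hi K b n) s =
      (if s \<in> {0<..b} \<and> \<not> (\<exists>k\<in>K. k < n \<and> s \<in> {lo k<..hi k}) then 1 else 0)" for n s
    unfolding step_fun_hole_steps[where lo = lo, OF lo] cnt by (auto simp: indicator_def)
  have "(\<lambda>n. \<integral>\<^sup>+ s. ?u n s \<partial>lebesgue) \<longlonglongrightarrow> (\<integral>\<^sup>+ (s :: real). 0 \<partial>lebesgue)"
  proof (rule nn_integral_dominated_convergence[where w = "indicator {0..1}"])
    show "?u n \<in> borel_measurable lebesgue" for n using S by measurable
    show "AE s in lebesgue. ?u n s \<le> indicator {0..1} s" for n
      using b unfolding step by (intro AE_I2) (auto simp: indicator_def split: if_splits)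
    have "AE s in lebesgue. s \<notin> range hi"
      by (intro AE_not_in null_sets_completionI countable_imp_null_set_lborel) simp
    then show "AE s in lebesgue. (\<lambda>n. ?u n s) \<longlonglongrightarrow> 0"
    proof eventually_elim
      fix s assume s: "s \<notin> range hi"
      have "\<exists>N. \<forall>n\<ge>N. ?u n s = 0"
      proof (cases "\<exists>k\<in>K. s \<in> {lo k<..hi k}")
        case True
        then obtain k where k: "k \<in> K" "s \<in> {lo k<..hi k}" by blast
        have "s \<in> {lo k<..<hi k}" using k s by (force simp: less_le)
        then have f: "?f s = 0" using k by (auto simp: indicator_def)
        have "step_fun (hole_steps lo hi K b n) s = 0" if "n \<ge> Suc k" for n
          unfolding step using k that by auto
        then show ?thesis using f by (intro exI[of _ "Suc k"]) simp
      next
        case False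
        then have "?u n s = 0" for n unfolding step by (auto simp: indicator_def)
        then show ?thesis by blast
      qed
      then show "(\<lambda>n. ?u n s) \<longlonglongrightarrow> 0"
        by (intro tendsto_eventually) (simp add: eventually_sequentially)
    qed
    show "(indicator {0..1} :: real \<Rightarrow> ennreal) \<in> borel_measurable lebesgue"
      by (rule borel_measurable_indicator) simp
  qed auto
  then show ?thesis by simp
qed

text \<open>The Wiener integrals in the mixture are known only up to null sets for each fixed time. Summability of the
  bounds \<open>\<kappa>\<close> gives pathwise convergence of the step integrals, hence the formula at all rational times
  simultaneously, and uniform convergence extends it to all times by continuity.\<close>

lemma mixture_path:
  fixes lo hi :: "nat \<Rightarrow> real"
  assumes W: "brownian Q W" and V: "brownian Q V" and a: "0 < a" "a < 1"
    and lh: "\<And>k. 0 \<le> lo k" "\<And>k. lo k \<le> hi k"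
    and disj: "disjoint_family_on (\<lambda>k. {lo k<..hi k}) K"
    and mix: "is_mixture Q W V (({0..1} - (\<Union>k\<in>K. {lo k<..<hi k})) \<inter> {0..a}) Y"
    and Y: "continuous_process Q Y" and \<kappa>: "summable \<kappa>"
  shows "AE x in Q. (\<forall>k. \<forall>\<omega>\<in>{W x, V x}. \<forall>t\<in>{0..a}. \<bar>increment_across \<omega> (lo k) (hi k) t\<bar> \<le> \<kappa> k) \<longrightarrow>
    (\<forall>t\<in>{0..1}. Y x t = W x (min t a) + V x t - V x (min t a) +
       (\<Sum>k. indicator K k * (increment_across (V x) (lo k) (hi k) (min t a) - increment_across (W x) (lo k) (hi k) (min t a))))"
proof -
  interpret W: brownian Q W by fact
  interpret V: brownian Q V by fact
  let ?E = "({0..1} - (\<Union>k\<in>K. {lo k<..<hi k})) \<inter> {0..a}"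
  obtain Z Z' where Z: "is_indicator_integral Q ?E W Z" and Z': "is_indicator_integral Q (- ?E) V Z'"
    and YZ: "AE x in Q. \<forall>t. Y x t = Z x t + Z' x t"
    using mix unfolding is_mixture_def by blast
  let ?h = "\<lambda>t n. hole_steps lo hi K (min t a) n"
  have Zt: "AE x in Q. \<forall>L. (\<lambda>n. step_integral (?h t n) (W x)) \<longlonglongrightarrow> L \<longrightarrow> Z x t = L"
    and Zt': "AE x in Q. \<forall>L. (\<lambda>n. step_integral ((1, 0, t) # neg_steps (?h t n)) (V x)) \<longlonglongrightarrow> L \<longrightarrow> Z' x t = L"
    if t: "t \<in> {0..1}" for t
  proof -
    have b: "0 \<le> min t a" "min t a \<le> 1" using t a by auto
    have eq: "?E \<inter> {0<..t} = {0<..min t a} - (\<Union>k\<in>K. {lo k<..<hi k})" using t a by auto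
    have o: "oriented_indicator ?E t s = indicator ({0<..min t a} - (\<Union>k\<in>K. {lo k<..<hi k})) s" for s
      unfolding oriented_indicator_def eq using t by simp
    have o': "oriented_indicator (- ?E) t s = indicator {0<..t} s - oriented_indicator ?E t s" for s
      unfolding oriented_indicator_def using t by (auto simp: indicator_def)
    note lim = hole_steps_tendsto[where lo = lo and hi = hi and K = K, OF lh(1) b disj]
    show "AE x in Q. \<forall>L. (\<lambda>n. step_integral (?h t n) (W x)) \<longlonglongrightarrow> L \<longrightarrow> Z x t = L"
      using Z lim hole_steps_ordered[where lo = lo and hi = hi, OF lh(2) b(1)]
      unfolding is_indicator_integral_def
      by (intro W.wiener_integral_eq_limit[where f = "oriented_indicator ?E t"]) (auto simp: o)
    have sf: "step_fun ((1, 0, t) # neg_steps m) s = indicator {0<..t} s - step_fun m s" for m s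
      using step_fun_append_neg[of "[(1, 0, t)]" m s] by (simp add: step_fun_def)
    have neg: "(oriented_indicator (- ?E) t s - step_fun ((1, 0, t) # neg_steps m) s)\<^sup>2 =
       (oriented_indicator ?E t s - step_fun m s)\<^sup>2" for m s
      unfolding o' sf by (simp add: power2_eq_square algebra_simps)
    show "AE x in Q. \<forall>L. (\<lambda>n. step_integral ((1, 0, t) # neg_steps (?h t n)) (V x)) \<longlonglongrightarrow> L \<longrightarrow> Z' x t = L"
    proof (rule V.wiener_integral_eq_limit[where f = "oriented_indicator (- ?E) t"])
      show "is_wiener_integral Q V (oriented_indicator (- ?E) t) (\<lambda>x. Z' x t)"
        using Z' unfolding is_indicator_integral_def by blast
      show "\<forall>(c, x, y)\<in>set ((1, 0, t) # neg_steps (?h t n)). x \<le> y" for n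
        using hole_steps_ordered[where lo = lo and hi = hi and K = K and n = n, OF lh(2) b(1)] t
        by (auto simp: neg_steps_def)
      show "(\<lambda>n. \<integral>\<^sup>+ s. ennreal ((oriented_indicator (- ?E) t s - step_fun ((1, 0, t) # neg_steps (?h t n)) s)\<^sup>2) \<partial>lebesgue) \<longlonglongrightarrow> 0"
        unfolding neg o by (rule lim)
    qed
  qed
  let ?T = "\<rat> \<inter> {0..1 :: real}"
  have "countable ?T" using countable_rat by blast
  then have "AE x in Q. \<forall>t\<in>?T. (\<forall>L. (\<lambda>n. step_integral (?h t n) (W x)) \<longlonglongrightarrow> L \<longrightarrow> Z x t = L) \<and>
      (\<forall>L. (\<lambda>n. step_integral ((1, 0, t) # neg_steps (?h t n)) (V x)) \<longlonglongrightarrow> L \<longrightarrow> Z' x t = L)"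
    using Zt Zt' by (subst AE_ball_countable) auto
  then show ?thesis
    using YZ AE_space
  proof eventually_elim
    fix x
    assume lims: "\<forall>t\<in>?T. (\<forall>L. (\<lambda>n. step_integral (?h t n) (W x)) \<longlonglongrightarrow> L \<longrightarrow> Z x t = L) \<and>
      (\<forall>L. (\<lambda>n. step_integral ((1, 0, t) # neg_steps (?h t n)) (V x)) \<longlonglongrightarrow> L \<longrightarrow> Z' x t = L)"
      and YZx: "\<forall>t. Y x t = Z x t + Z' x t" and x: "x \<in> space Q"
    note cW = W.path_continuous[OF x] and cV = V.path_continuous[OF x]
    have cY: "continuous_on UNIV (Y x)" using Y x unfolding continuous_process_def by auto
    let ?J = "\<lambda>\<omega> k t. increment_across \<omega> (lo k) (hi k) (min t a)"
    let ?R = "\<lambda>t. W x (min t a) + V x t - V x (min t a) + (\<Sum>k. indicator K k * (?J (V x) k t - ?J (W x) k t))"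
    show "(\<forall>k. \<forall>\<omega>\<in>{W x, V x}. \<forall>t\<in>{0..a}. \<bar>increment_across \<omega> (lo k) (hi k) t\<bar> \<le> \<kappa> k) \<longrightarrow>
       (\<forall>t\<in>{0..1}. Y x t = ?R t)"
    proof (intro impI)
      assume small: "\<forall>k. \<forall>\<omega>\<in>{W x, V x}. \<forall>t\<in>{0..a}. \<bar>increment_across \<omega> (lo k) (hi k) t\<bar> \<le> \<kappa> k"
      have bound: "\<bar>indicator K k * ?J \<omega> k t\<bar> \<le> \<kappa> k" if "\<omega> \<in> {W x, V x}" "t \<in> {0..1}" for \<omega> k t
      proof -
        have "\<bar>?J \<omega> k t\<bar> \<le> \<kappa> k" using small that a by auto
        then show ?thesis by (auto simp: indicator_def)
      qed
      have sums: "summable (\<lambda>k. indicator K k * ?J \<omega> k t)" if "\<omega> \<in> {W x, V x}" "t \<in> {0..1}" for \<omega> t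
        using bound[OF that] by (intro summable_comparison_test'[OF \<kappa>, of 0]) simp
      have rational: "Y x t = ?R t" if t: "t \<in> ?T" for t
      proof -
        have t01: "t \<in> {0..1}" using t by simp
        have "(\<lambda>n. step_integral (?h t n) (W x)) \<longlonglongrightarrow> W x (min t a) - (\<Sum>k. indicator K k * ?J (W x) k t)"
          unfolding step_integral_hole_steps W.path_0[OF x] diff_0_right
          by (intro tendsto_diff tendsto_const summable_LIMSEQ sums t01) simp
        then have 1: "Z x t = W x (min t a) - (\<Sum>k. indicator K k * ?J (W x) k t)" using lims t by blast
        have si: "step_integral ((1, 0, t) # neg_steps m) \<beta> = \<beta> t - \<beta> 0 - step_integral m \<beta>" for m \<beta>
          using step_integral_append_neg[of "[(1, 0, t)]" m \<beta>] by (simp add: step_integral_def)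
        have "(\<lambda>n. step_integral ((1, 0, t) # neg_steps (?h t n)) (V x)) \<longlonglongrightarrow>
            V x t - (V x (min t a) - (\<Sum>k. indicator K k * ?J (V x) k t))"
          unfolding si step_integral_hole_steps V.path_0[OF x] diff_0_right
          by (intro tendsto_diff tendsto_const summable_LIMSEQ sums t01) simp
        then have 2: "Z' x t = V x t - (V x (min t a) - (\<Sum>k. indicator K k * ?J (V x) k t))"
          using lims t by blast
        have "(\<Sum>k. indicator K k * (?J (V x) k t - ?J (W x) k t)) =
            (\<Sum>k. indicator K k * ?J (V x) k t) - (\<Sum>k. indicator K k * ?J (W x) k t)"
          unfolding right_diff_distrib by (intro suminf_diff[symmetric] sums t01) auto
        then show ?thesis using YZx 1 2 by simp
      qed
      define cl where "cl t = max 0 (min 1 t)" for t :: real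
      have cl: "cl t \<in> {0..1}" for t by (simp add: cl_def)
      have ccl: "continuous_on UNIV cl" unfolding cl_def[abs_def] by (intro continuous_intros)
      have cc: "continuous_on UNIV (\<lambda>t. \<omega> (min c (min (cl t) a)))" "continuous_on UNIV (\<lambda>t. \<omega> (min (cl t) a))"
        "continuous_on UNIV (\<lambda>t. \<omega> (cl t))" if "continuous_on UNIV \<omega>" for \<omega> :: "real \<Rightarrow> real" and c
        by (intro continuous_on_compose2[OF that] continuous_intros ccl; simp)+
      have "uniform_limit UNIV (\<lambda>n t. \<Sum>k<n. indicator K k * (?J (V x) k (cl t) - ?J (W x) k (cl t)))
          (\<lambda>t. \<Sum>k. indicator K k * (?J (V x) k (cl t) - ?J (W x) k (cl t))) sequentially"
      proof (rule Weierstrass_m_test)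
        show "norm (indicator K k * (?J (V x) k (cl t) - ?J (W x) k (cl t))) \<le> \<kappa> k + \<kappa> k" for k t
        proof -
          have "\<bar>indicator K k * ?J (V x) k (cl t) - indicator K k * ?J (W x) k (cl t)\<bar> \<le> \<kappa> k + \<kappa> k"
            using bound[of "V x" "cl t" k] bound[of "W x" "cl t" k] cl[of t]
            by (intro order_trans[OF abs_triangle_ineq4 add_mono]) auto
          then show ?thesis by (simp add: right_diff_distrib)
        qed
      qed (intro summable_add \<kappa>)
      then have cont_sum: "continuous_on UNIV (\<lambda>t. \<Sum>k. indicator K k * (?J (V x) k (cl t) - ?J (W x) k (cl t)))"
      proof (rule uniform_limit_theorem[rotated])
        show "\<forall>\<^sub>F n in sequentially. continuous_on UNIV
            (\<lambda>t. \<Sum>k<n. indicator K k * (?J (V x) k (cl t) - ?J (W x) k (cl t)))"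
          unfolding increment_across_def
          by (intro always_eventually allI continuous_on_sum continuous_on_mult continuous_on_const
              continuous_on_diff cc cV cW)
      qed simp
      have "continuous_on UNIV (\<lambda>t. Y x (cl t) - ?R (cl t))"
        by (intro continuous_on_diff continuous_on_add cont_sum cc cV cW cY)
      moreover have "Y x (cl t) - ?R (cl t) = 0" if "t \<in> \<rat>" for t
      proof -
        have "cl t \<in> ?T" using that cl[of t] by (auto simp: cl_def max_def min_def)
        then show ?thesis using rational by simp
      qed
      ultimately have zero: "Y x (cl t) - ?R (cl t) = 0" for t
        using continuous_constant_on_closure[of \<rat> "\<lambda>t. Y x (cl t) - ?R (cl t)" 0 t]
        by (simp add: Rats_closure_real)
      show "\<forall>t\<in>{0..1}. Y x t = ?R t"
      proof
        fix t :: real assume "t \<in> {0..1}"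
        then have "cl t = t" by (simp add: cl_def)
        then show "Y x t = ?R t" using zero[of t] by simp
      qed
    qed
  qed
qed



section \<open>The decreasing sequence of sets\<close>

text \<open>A measure and its completion agree on the sets that are measurable before completion.\<close>

lemma distr_completion:
  assumes p: "p \<in> Q \<rightarrow>\<^sub>M completion N" and d: "distr Q (completion N) p = completion N"
  shows "p \<in> Q \<rightarrow>\<^sub>M N" "distr Q N p = N"
proof -
  show p': "p \<in> Q \<rightarrow>\<^sub>M N"
    using p unfolding measurable_def by auto
  show "distr Q N p = N"
  proof (rule measure_eqI)
    fix A assume "A \<in> sets (distr Q N p)"
    then have A: "A \<in> sets N" by simp
    have "emeasure (distr Q N p) A = emeasure (distr Q (completion N) p) A"
      using A p p' by (simp add: emeasure_distr sets_completionI_sets)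
    then show "emeasure (distr Q N p) A = emeasure N A" using A d by simp
  qed simp
qed

text \<open>First \<open>h\<close> is chosen such that \<open>V\<close> rises by at most \<open>h\<close> after \<open>a\<close> with positive probability. Independently,
  \<open>W\<close> falls by \<open>2 h + 1\<close> before \<open>a\<close> with positive probability.\<close>

lemma independent_start_pos:
  assumes W: "brownian Q W" and V: "brownian Q V"
    and Wp: "W \<in> Q \<rightarrow>\<^sub>M path_space" and Vp: "V \<in> Q \<rightarrow>\<^sub>M path_space"
    and ind: "prob_space.indep_var Q path_space W path_space V"
    and a: "0 < a" "a < 1"
  shows "\<exists>h\<ge>0. {x \<in> space Q. 0 < W x (a / 2) \<and> maxval (W x) a 1 \<le> W x (a / 2) - (2 * h + 1) \<and>
      maxval (V x) a 1 \<le> V x a + h} \<in> sets Q \<and>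
    measure Q {x \<in> space Q. 0 < W x (a / 2) \<and> maxval (W x) a 1 \<le> W x (a / 2) - (2 * h + 1) \<and>
      maxval (V x) a 1 \<le> V x a + h} > 0"
proof -
  interpret W: brownian Q W by fact
  interpret V: brownian Q V by fact
  have a1: "a \<le> 1" using a by simp
  have mx: "(\<lambda>\<omega>. maxval \<omega> a 1) \<in> borel_measurable path_space"
    using maxval_measurable[OF path_space_process a1] .
  define val where "val t \<omega> = \<omega> t" for t and \<omega> :: "real \<Rightarrow> real"
  have val: "val t \<in> borel_measurable path_space" for t
    using path_space_process unfolding continuous_process_def val_def[abs_def] by auto
  obtain h where h: "h \<ge> 0" "W.prob {x \<in> space Q. maxval (\<lambda>t. V x t - V x a) a 1 > h} < 1"
    using V.maxval_bounded_prob[OF a1, of 1 a] by auto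
  define S where "S = {\<omega> \<in> space path_space. 0 < val (a / 2) \<omega> \<and> maxval \<omega> a 1 \<le> val (a / 2) \<omega> - (2 * h + 1)}"
  define T where "T = {\<omega> \<in> space path_space. maxval \<omega> a 1 \<le> val a \<omega> + h}"
  have S: "S \<in> sets path_space" unfolding S_def
    by (intro sets.sets_Collect_conj borel_measurable_less borel_measurable_le borel_measurable_diff
        borel_measurable_add borel_measurable_const mx val)
  have T: "T \<in> sets path_space" unfolding T_def
    by (intro sets.sets_Collect_conj borel_measurable_less borel_measurable_le borel_measurable_diff
        borel_measurable_add borel_measurable_const mx val)
  have sp: "W x \<in> space path_space" "V x \<in> space path_space" if "x \<in> space Q" for x
    using measurable_space[OF Wp that] measurable_space[OF Vp that] by auto
  have "W -` S \<inter> space Q = {x \<in> space Q. 0 < W x (a / 2) \<and> maxval (W x) a 1 \<le> W x (a / 2) - (2 * h + 1)}"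
    unfolding S_def val_def using sp by auto
  then have pS: "W.prob (W -` S \<inter> space Q) > 0" using W.descent_prob_pos[OF a] by simp
  have "V -` T \<inter> space Q = space Q - {x \<in> space Q. maxval (\<lambda>t. V x t - V x a) a 1 > h}"
    unfolding T_def val_def using sp maxval_shift[OF V.path_continuous a1] by auto
  moreover have "{x \<in> space Q. maxval (\<lambda>t. V x t - V x a) a 1 > h} \<in> sets Q"
  proof -
    have "{x \<in> space Q. maxval (\<lambda>t. V x t - V x a) a 1 > h} = space Q - (V -` T \<inter> space Q)"
      unfolding T_def val_def using sp maxval_shift[OF V.path_continuous a1] by auto
    then show ?thesis using measurable_sets[OF Vp T] by simp
  qed
  ultimately have pT: "W.prob (V -` T \<inter> space Q) > 0"
    using h(2) by (simp add: W.prob_compl)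
  have eq: "(\<lambda>x. (W x, V x)) -` (S \<times> T) \<inter> space Q = {x \<in> space Q. 0 < W x (a / 2) \<and>
      maxval (W x) a 1 \<le> W x (a / 2) - (2 * h + 1) \<and> maxval (V x) a 1 \<le> V x a + h}"
    unfolding S_def T_def val_def using sp by auto
  have "(\<lambda>x. (W x, V x)) -` (S \<times> T) \<inter> space Q = (W -` S \<inter> space Q) \<inter> (V -` T \<inter> space Q)" by auto
  then have "(\<lambda>x. (W x, V x)) -` (S \<times> T) \<inter> space Q \<in> sets Q"
    using measurable_sets[OF Wp S] measurable_sets[OF Vp T] by simp
  moreover have "W.prob ((\<lambda>x. (W x, V x)) -` (S \<times> T) \<inter> space Q) > 0"
    using W.indep_varD[OF ind S T] pS pT by simp
  ultimately show ?thesis using h(1) unfolding eq by blast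
qed

theorem mainTheorem8:
  fixes P :: "(real \<Rightarrow> real) measure"
    and Q :: "'q measure"
    and W W' :: "'q \<Rightarrow> real \<Rightarrow> real"
    and W_mix :: "real set \<Rightarrow> 'q \<Rightarrow> real \<Rightarrow> real"
  assumes "completed_wiener_measure P"
    and "complete_extension P Q W"
    and "two_sided_brownian_motion Q W'"
    and "W' \<in> Q \<rightarrow>\<^sub>M path_space"
    and "prob_space.indep_var Q path_space W path_space W'"
    and "\<And>E. E \<in> sets lebesgue \<Longrightarrow> is_mixture Q W W' E (W_mix E)"
  shows "\<exists>E :: nat \<Rightarrow> real set.
    (\<forall>n. closed (E n) \<and> nowhere_dense (E n) \<and> E n \<subseteq> {0..1}) \<and>
    (\<forall>n. E (Suc n) \<subseteq> E n) \<and>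
    emeasure lebesgue (\<Inter>n. E n) = 0 \<and>
    (\<forall>n. measure Q {x \<in> space Q. maximizer (W x) = maximizer (W_mix (E n) x)} > 0)"
proof -
  obtain N where N: "sets N = sets path_space" "two_sided_brownian_motion N (\<lambda>\<omega>. \<omega>)" "P = completion N"
    using assms(1) unfolding completed_wiener_measure_def by blast
  have Q: "prob_space Q" and WP: "W \<in> Q \<rightarrow>\<^sub>M completion N" "distr Q (completion N) W = completion N"
    using assms(2) N(3) unfolding complete_extension_def by auto
  note WN = distr_completion[OF WP]
  have "two_sided_brownian_motion Q W"
    using two_sided_brownian_motion_distr[OF Q WN N(2)] .
  then interpret W: brownian Q W using Q by (simp add: brownian_def brownian_axioms_def)
  interpret V: brownian Q W' using Q assms(3) by (simp add: brownian_def brownian_axioms_def)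
  have Wp: "W \<in> Q \<rightarrow>\<^sub>M path_space" using WN(1) N(1) by (simp cong: measurable_cong_sets)
  define a where "a n = 1 / real (n + 2)" for n :: nat
  have a: "0 < a n" "a n < 1" for n by (auto simp: a_def)
  define start where "start n h = {x \<in> space Q. 0 < W x (a n / 2) \<and>
      maxval (W x) (a n) 1 \<le> W x (a n / 2) - (2 * h + 1) \<and> maxval (W' x) (a n) 1 \<le> W' x (a n) + h}" for n h
  have "\<forall>n. \<exists>h. h \<ge> 0 \<and> start n h \<in> sets Q \<and> W.prob (start n h) > 0"
    using independent_start_pos[OF W.brownian_axioms V.brownian_axioms Wp assms(4,5) a]
    unfolding start_def by blast
  then obtain h where h: "\<And>n. h n \<ge> 0" and h': "\<And>n. start n (h n) \<in> sets Q" "\<And>n. W.prob (start n (h n)) > 0"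
    by metis
  define H where "H n = start n (h n)" for n
  have H: "H n \<in> sets Q" and Hpos: "W.prob (H n) > 0" for n
    using h' unfolding H_def by auto

  define S where "S = {p :: real \<times> real. fst p \<in> \<rat> \<and> snd p \<in> \<rat> \<and> 0 < fst p \<and> fst p < snd p \<and> snd p < 1}"
  have "S \<subseteq> \<rat> \<times> \<rat>" by (auto simp: S_def)
  moreover have "countable (\<rat> \<times> \<rat> :: (real \<times> real) set)" by (intro countable_SIGMA countable_rat)
  ultimately have "countable S" by (rule countable_subset)
  moreover have "(1 / 3, 1 / 2) \<in> S" by (simp add: S_def)
  ultimately obtain J :: "nat \<Rightarrow> real \<times> real" where J: "range J = S"
    using range_from_nat_into[of S] by blast
  have JS: "0 < fst (J k)" "fst (J k) < snd (J k)" "snd (J k) < 1" for k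
  proof -
    have "J k \<in> S" using J by blast
    then show "0 < fst (J k)" "fst (J k) < snd (J k)" "snd (J k) < 1" by (auto simp: S_def)
  qed
  \<comment> \<open>A hole inside \<open>J k\<close> can meet \<open>[0, a n]\<close> only for \<open>n \<le> N0 k\<close>; so its exceptional event can be made small against the finitely many probabilities that it may affect.\<close>
  define N0 where "N0 k = nat \<lceil>1 / fst (J k)\<rceil>" for k
  define e where "e k = (1 / 2) ^ (k + 2) * Min ((\<lambda>n. W.prob (H n)) ` {..N0 k})" for k
  have e: "e k > 0" for k unfolding e_def using Hpos by (intro mult_pos_pos) auto
  have e_le: "e k \<le> (1 / 2) ^ (k + 2) * W.prob (H n)" if "fst (J k) < a n" for k n
  proof -
    have "real (n + 2) < 1 / fst (J k)" using that JS(1)[of k] unfolding a_def by (simp add: field_simps)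
    then have "n \<le> N0 k" unfolding N0_def by linarith
    then show ?thesis unfolding e_def by (intro mult_left_mono Min_le) auto
  qed
  define tame where "tame k lo hi x \<longleftrightarrow> (\<forall>\<omega>\<in>{W x, W' x}. \<forall>t\<in>{0..1}.
      \<bar>increment_across \<omega> lo hi t\<bar> \<le> (1 / 2) ^ (k + 3) \<and>
      \<bar>increment_across \<omega> lo hi t - increment_across \<omega> lo hi (first_max (W x) 0 1)\<bar>
         \<le> (1 / 2) ^ (k + 3) * (W x (first_max (W x) 0 1) - W x t))" for k lo hi x
  have "\<exists>lo hi A. fst (J k) < lo \<and> lo < hi \<and> hi < snd (J k) \<and> A \<in> sets Q \<and> W.prob A < e k \<and>
    (\<forall>x\<in>space Q - A. tame k lo hi x)" for k
    unfolding tame_def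
    by (rule W.quiet_interval[OF W.continuous_process V.continuous_process W.unique_maximum JS(2) _ e]) simp
  then obtain lo hi A where lh: "\<And>k. fst (J k) < lo k" "\<And>k. lo k < hi k" "\<And>k. hi k < snd (J k)"
    and A: "\<And>k. A k \<in> sets Q" "\<And>k. W.prob (A k) < e k"
    and tame: "\<And>k x. x \<in> space Q - A k \<Longrightarrow> tame k (lo k) (hi k) x"
    by metis
  have lo_pos: "0 \<le> lo k" for k using lh(1)[of k] JS(1)[of k] by linarith
  have le: "lo k \<le> hi k" for k using lh(2) less_imp_le by blast
  have "{lo k<..hi k} \<noteq> {}" for k using lh(2)[of k] by auto
  from maximal_disjoint_subfamily[of "\<lambda>k. {lo k<..hi k}", OF this]
  obtain K where disj: "disjoint_family_on (\<lambda>k. {lo k<..hi k}) K"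
    and maximal: "\<And>k. \<exists>j\<in>K. {lo k<..hi k} \<inter> {lo j<..hi j} \<noteq> {}" by blast

  define F where "F = {0..1} - (\<Union>k\<in>K. {lo k<..<hi k})"
  define E where "E n = F \<inter> {0..a n}" for n
  have "closed F" unfolding F_def by (intro closed_Diff open_UN) auto
  then have closed: "closed (E n)" for n unfolding E_def by (intro closed_Int) auto
  have "interior F = {}"
    unfolding F_def
  proof (rule interior_minus_intervals)
    show "\<exists>k. u < lo k \<and> hi k < v" if "u \<in> \<rat>" "v \<in> \<rat>" "0 < u" "u < v" "v < 1" for u v
    proof -
      have "(u, v) \<in> range J" unfolding J using that by (simp add: S_def)
      then obtain k where "J k = (u, v)" by force
      then show ?thesis using lh(1,3)[of k] by auto
    qed
  qed (use lh(2) maximal in auto)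
  then have nowhere: "nowhere_dense (E n)" for n
    unfolding nowhere_dense_def closure_closed[OF closed]
    using interior_mono[of "E n" F] unfolding E_def by auto
  have a_dec: "a (Suc n) \<le> a n" for n unfolding a_def by (simp add: field_simps)
  have "(\<Inter>n. E n) \<subseteq> {0}"
  proof
    fix x assume x: "x \<in> (\<Inter>n. E n)"
    have "x \<le> 0"
    proof (rule ccontr)
      assume "\<not> x \<le> 0"
      then obtain n where "inverse (real (Suc n)) < x" using reals_Archimedean[of x] by auto
      moreover have "a n \<le> inverse (real (Suc n))" unfolding a_def by (simp add: field_simps)
      moreover have "x \<le> a n" using x unfolding E_def by auto
      ultimately show False by linarith
    qed
    then show "x \<in> {0}" using x unfolding E_def by auto
  qed
  then have null: "emeasure lebesgue (\<Inter>n. E n) = 0"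
    using emeasure_mono[of "\<Inter>n. E n" "{0}" lebesgue] by simp
  have geo: "summable (\<lambda>k. (1 / 2 :: real) ^ (k + 3))" "(\<lambda>k. (1 / 2 :: real) ^ (k + 2)) sums (1 / 2)"
    using summable_mult2[OF summable_geometric[of "1 / 2 :: real"], of "(1 / 2) ^ 3"]
      sums_mult2[OF geometric_sums[of "1 / 2 :: real"], of "(1 / 2) ^ 2"]
    by (auto simp: power_add power2_eq_square)

  have "W.prob {x \<in> space Q. maximizer (W x) = maximizer (W_mix (E n) x)} > 0" for n
  proof -
    let ?Y = "W_mix (E n)" and ?T = "{x \<in> space Q. maximizer (W x) = maximizer (W_mix (E n) x)}"
    have "E n \<in> sets lebesgue" using closed by (simp add: borel_closed)
    then have mix: "is_mixture Q W W' (E n) ?Y" by (rule assms(6))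
    then have Y: "continuous_process Q ?Y"
      using continuous_process_compose[OF path_space_process] unfolding is_mixture_def by blast
    have E_eq: "E n = ({0..1} - (\<Union>k\<in>K. {lo k<..<hi k})) \<inter> {0..a n}" by (simp add: E_def F_def)
    have mix': "is_mixture Q W W' (({0..1} - (\<Union>k\<in>K. {lo k<..<hi k})) \<inter> {0..a n}) ?Y"
      by (subst E_eq[symmetric]) (rule mix)
    \<comment> \<open>Only the holes that meet \<open>[0, a n]\<close> matter.\<close>
    define R where "R k = (if lo k < a n then A k else {})" for k
    have R: "R k \<in> sets Q" "W.prob (R k) \<le> (1 / 2) ^ (k + 2) * W.prob (H n)" for k
    proof -
      show "R k \<in> sets Q" using A by (simp add: R_def)
      have "W.prob (A k) \<le> (1 / 2) ^ (k + 2) * W.prob (H n)" if "lo k < a n"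
        using A(2)[of k] e_le[of k n] lh(1)[of k] that by linarith
      then show "W.prob (R k) \<le> (1 / 2) ^ (k + 2) * W.prob (H n)" by (simp add: R_def)
    qed
    have maj: "(\<lambda>k. (1 / 2) ^ (k + 2) * W.prob (H n)) sums (1 / 2 * W.prob (H n))"
      by (rule sums_mult2[OF geo(2)])
    have Rs: "summable (\<lambda>k. W.prob (R k))"
      using R(2) by (intro summable_comparison_test'[OF sums_summable[OF maj], of 0]) simp
    have "W.prob (\<Union>k. R k) \<le> (\<Sum>k. W.prob (R k))"
      using R(1) Rs by (intro W.finite_measure_subadditive_countably) auto
    also have "\<dots> \<le> (\<Sum>k. (1 / 2) ^ (k + 2) * W.prob (H n))"
      using R(2) Rs sums_summable[OF maj] by (intro suminf_le) auto
    also have "\<dots> = 1 / 2 * W.prob (H n)" using sums_unique[OF maj] by simp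
    finally have "W.prob (\<Union>k. R k) \<le> 1 / 2 * W.prob (H n)" .
    moreover have "W.prob (H n) \<le> W.prob ((H n - (\<Union>k. R k)) \<union> (\<Union>k. R k))"
      using H R(1) by (intro W.finite_measure_mono) auto
    moreover have "\<dots> \<le> W.prob (H n - (\<Union>k. R k)) + W.prob (\<Union>k. R k)"
      using H R(1) by (intro measure_Un_le) auto
    ultimately have "0 < W.prob (H n - (\<Union>k. R k))" using Hpos[of n] by linarith
    also have "\<dots> \<le> W.prob ?T"
    proof (rule W.finite_measure_mono_AE)
      show "?T \<in> sets Q" by (rule same_maximizer_measurable[OF W.continuous_process Y])
      have far: "increment_across \<omega> (lo k) (hi k) t = 0" if "\<not> lo k < a n" "t \<le> a n" for \<omega> k t
      proof -
        have "min (hi k) t = t" "min (lo k) t = t" using that le[of k] by auto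
        then show ?thesis by (simp add: increment_across_def)
      qed
      show "AE x in Q. x \<in> H n - (\<Union>k. R k) \<longrightarrow> x \<in> ?T"
        using W.unique_maximum AE_space
          mixture_path[OF W.brownian_axioms V.brownian_axioms a lo_pos le disj mix' Y geo(1)]
      proof eventually_elim
        fix x
        assume uniq: "first_max (W x) 0 1 = last_max (W x) 0 1" and x: "x \<in> space Q"
          and path: "(\<forall>k. \<forall>\<omega>\<in>{W x, W' x}. \<forall>t\<in>{0..a n}. \<bar>increment_across \<omega> (lo k) (hi k) t\<bar> \<le> (1 / 2) ^ (k + 3)) \<longrightarrow>
             (\<forall>t\<in>{0..1}. ?Y x t = W x (min t (a n)) + W' x t - W' x (min t (a n)) +
               (\<Sum>k. indicator K k * (increment_across (W' x) (lo k) (hi k) (min t (a n)) -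
                  increment_across (W x) (lo k) (hi k) (min t (a n)))))"
        show "x \<in> H n - (\<Union>k. R k) \<longrightarrow> x \<in> ?T"
        proof
          assume good: "x \<in> H n - (\<Union>k. R k)"
          have early: "first_max (W x) 0 1 \<le> a n"
          proof (rule ccontr)
            assume "\<not> ?thesis"
            then have "maxval (W x) 0 1 \<le> maxval (W x) (a n) 1"
              using first_max_props(1,2)[OF W.path_continuous[OF x], of 0 1]
                maxval_upper[OF W.path_continuous[OF x], of "first_max (W x) 0 1" "a n" 1] by auto
            moreover have "W x (a n / 2) \<le> maxval (W x) 0 1"
              using a[of n] by (intro maxval_upper[OF W.path_continuous[OF x]]) auto
            ultimately show False using good h[of n] unfolding H_def start_def by auto
          qed
          have small: "\<bar>increment_across \<omega> (lo k) (hi k) t\<bar> \<le> (1 / 2) ^ (k + 3)"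
            and close: "\<bar>increment_across \<omega> (lo k) (hi k) t - increment_across \<omega> (lo k) (hi k) (first_max (W x) 0 1)\<bar>
              \<le> (1 / 2) ^ (k + 3) * (W x (first_max (W x) 0 1) - W x t)"
            if "\<omega> \<in> {W x, W' x}" "t \<in> {0..a n}" for k \<omega> t
          proof -
            have t: "t \<in> {0..1}" using that a[of n] by auto
            have top: "W x t \<le> W x (first_max (W x) 0 1)"
              using first_max_props(2)[OF W.path_continuous[OF x], of 0 1]
                maxval_upper[OF W.path_continuous[OF x] t] by simp
            show "\<bar>increment_across \<omega> (lo k) (hi k) t\<bar> \<le> (1 / 2) ^ (k + 3)"
              "\<bar>increment_across \<omega> (lo k) (hi k) t - increment_across \<omega> (lo k) (hi k) (first_max (W x) 0 1)\<bar>
              \<le> (1 / 2) ^ (k + 3) * (W x (first_max (W x) 0 1) - W x t)"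
            proof -
              have "x \<in> space Q - A k" if "lo k < a n" using good x that by (auto simp: R_def)
              then have "tame k (lo k) (hi k) x" if "lo k < a n" using tame that by blast
              then have near: "\<bar>increment_across \<omega> (lo k) (hi k) t\<bar> \<le> (1 / 2) ^ (k + 3)"
                "\<bar>increment_across \<omega> (lo k) (hi k) t - increment_across \<omega> (lo k) (hi k) (first_max (W x) 0 1)\<bar>
                  \<le> (1 / 2) ^ (k + 3) * (W x (first_max (W x) 0 1) - W x t)" if "lo k < a n"
                using that \<open>\<omega> \<in> {W x, W' x}\<close> t unfolding tame_def by blast+
              show "\<bar>increment_across \<omega> (lo k) (hi k) t\<bar> \<le> (1 / 2) ^ (k + 3)"
                using near(1) far[of k t \<omega>] that(2) by (cases "lo k < a n") auto
              show "\<bar>increment_across \<omega> (lo k) (hi k) t - increment_across \<omega> (lo k) (hi k) (first_max (W x) 0 1)\<bar>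
                \<le> (1 / 2) ^ (k + 3) * (W x (first_max (W x) 0 1) - W x t)"
                using near(2) far[of k t \<omega>] far[of k "first_max (W x) 0 1" \<omega>] early that(2) top
                by (cases "lo k < a n") auto
            qed
          qed
          have "maximizer (W x) = maximizer (?Y x)"
          proof (rule same_maximum[where a = "a n" and h = "h n" and lo = lo and hi = hi and c = "indicator K" and v = "W' x"])
            show "?Y x t = W x (min t (a n)) + W' x t - W' x (min t (a n)) +
               (\<Sum>k. indicator K k * (increment_across (W' x) (lo k) (hi k) (min t (a n)) -
                  increment_across (W x) (lo k) (hi k) (min t (a n))))" if "t \<in> {0..1}" for t
              using path small that by blast
            show "\<bar>indicator K k\<bar> \<le> (1 :: real)" for k by (simp add: indicator_def)
          qed (use a h uniq x W.path_continuous V.path_continuous W.path_0 good small close in \<open>auto simp: H_def start_def\<close>)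
          then show "x \<in> ?T" using x by simp
        qed
      qed
    qed
    finally show ?thesis .
  qed
  moreover have "E (Suc n) \<subseteq> E n" "E n \<subseteq> {0..1}" for n
    using a_dec[of n] unfolding E_def F_def by auto
  ultimately show ?thesis
    using closed nowhere null by (intro exI[of _ E] conjI allI) auto
qed

end
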